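(* Consider a Bayesian bandit problem with horizon $T$ and let $A_1,\dots,A_T$ be the actions of Thompson Sampling (TS). Let $\varepsilon\ge 0$ and let $\{\mathcal{A}_k\}_{k=1}^K$ be a partition of $\mathcal{A}$ such that for each $k$ and all $a,a'\in\mathcal{A}_k$, $\mathbb{E}[R(a,\pi_\star^{-1}(a))-R(a',\pi_\star^{-1}(a))]\le\varepsilon$. Let $A^\star_\varepsilon$ be the statistic defined by $A^\star_\varepsilon=k\iff A^\star\in\mathcal{A}_k$, and let $\hat A_{t,\varepsilon}$ be defined by $\hat A_{t,\varepsilon}=k\iff A_t\in\mathcal{A}_k$. For each $t\in\{1,\dots,T\}$ let $\phi_t$ be a random function and let $\tilde A^\star_t=\phi_t(A^\star_\varepsilon)$ and $\tilde A_{t,\varepsilon}=\phi_t(\hat A_{t,\varepsilon})$ satisfy 1. $\mathbb{E}_t[R(A^\star)-R(A_t)]\le\varepsilon+\mathbb{E}_t[R(\tilde A^\star_t)-R(\tilde A_{t,\varepsilon})]$, and 2. $\mathrm{I}_t\big(A^\star_\varepsilon;\tilde A_{t,\varepsilon},R(\tilde A_{t,\varepsilon})\big)\le \mathrm{I}_t\big(A^\star_\varepsilon;A_t,R(A_t)\big)$. Define the one-step compressed TS information ratio $$\tilde\Gamma_t(\tilde A^\star_t,\tilde A_{t,\varepsilon})=\frac{\mathbb{E}_t[R(\tilde A^\star_t)-R(\tilde A_{t,\varepsilon})]^2}{\mathrm{I}_t\big(A^\star_\varepsilon;\tilde A_{t,\varepsilon},R(\tilde A_{t,\varepsilon})\big)}.$$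 Assume that $\frac1T\sum_{t=1}^T\mathbb{E}[\tilde\Gamma_t(\tilde A^\star_t,\tilde A_{t,\varepsilon})]\le\tilde\Gamma$ for some $\tilde\Gamma>0$. Then the TS cumulative regret satisfies $$\mathbb{E}[\mathrm{Regret}(T)]\le\sqrt{\tilde\Gamma\,T\,\mathrm{H}(A^\star_\varepsilon)}+\varepsilon T.$$
   Context: Bandit problem: $\mathcal{A}$ is a compact action set (possibly infinite or continuous) and $\mathcal{O}$ a parameter set. A parameter $\Theta\in\mathcal{O}$ is drawn from a known prior $\mathbb{P}_\Theta$. At each $t=1,\dots,T$ the agent picks $A_t\in\mathcal{A}$ based on the history $H^t$ (and independent internal randomization) and receives a real reward $R_t=R(A_t,\Theta)$, where $R:\mathcal{A}\times\mathcal{O}\to\mathbb{R}$ is a possibly random function: given action $a$ and $\Theta=\theta$ the reward has law $\mathbb{P}_{R|A=a,\Theta=\theta}$ and is otherwise independent of the past. $H^1$ is empty and $H^{t+1}=H^t\cup\{A_t,R_t\}$. All sets and maps are measurable, and rewards are integrable wherever expectations are taken. $R(A)$ abbreviates $R(A,\Theta)$ for a (random) action $A$. Optimal action: $\pi_\star:\mathcal{O}\to\mathcal{A}$, $\pi_\star(\theta)=\mathrm{argmax}_{a\in\mathcal{A}}\mathbb{E}[R(a,\theta)]$ (expectation over the reward distribution), is assumed to exist and to be a one-to-one correspondence between parameters and actions, with inverse $\pi_\star^{-1}$; $A^\star=\pi_\star(\Theta)$. Thompson Sampling: at each $t$, sample $\hat\Theta_t\sim\mathbb{P}_{\Theta|H^t}$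 (conditionally independent of $\Theta$ given $H^t$) and play $A_t=\pi_\star(\hat\Theta_t)$. Regret: $\mathbb{E}[\mathrm{Regret}(T)]=\mathbb{E}\big[\sum_{t=1}^T R(A^\star,\Theta)-R(A_t,\Theta)\big]$. Notation: $\mathbb{E}_t[\cdot]=\mathbb{E}[\cdot|H^t]$; $\mathbb{E}_t[X]^2$ means $(\mathbb{E}_t[X])^2$; $\mathrm{I}_t(X;Y)$ is the mutual information of $X$ and $Y$ under the conditional law given the realized history $H^t$ (a random variable that is a function of $H^t$); $\mathrm{H}$ is Shannon entropy, in nats. A random function $\phi_t:\{1,\dots,K\}\to\mathcal{A}$ is a random map that may depend on $H^t$ and on internal randomization independent, given $H^t$, of $\Theta$, $\hat\Theta_t$ and the reward noise. The ratio $\tilde\Gamma_t$ is $0$ when numerator and denominator both vanish, and $+\infty$ when only the denominator vanishes. *)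

theory Defs
  imports "HOL-Probability.Probability"
begin

section \<open>Conditioning on a random variable\<close>

text \<open>Throughout, a random variable \<open>H\<close> with values in \<open>N\<close> is conditioned on through the
  sub-\<open>\<sigma>\<close>-algebra that it generates.\<close>

definition cond_exp_given ::
  "'w measure \<Rightarrow> 'h measure \<Rightarrow> ('w \<Rightarrow> 'h) \<Rightarrow> ('w \<Rightarrow> real) \<Rightarrow> 'w \<Rightarrow> real" where
  "cond_exp_given M N H f = real_cond_exp M (vimage_algebra (space M) H N) f"

definition regular_cond_law ::
  "'w measure \<Rightarrow> 'h measure \<Rightarrow> ('w \<Rightarrow> 'h) \<Rightarrow> 's measure \<Rightarrow> ('w \<Rightarrow> 's) \<Rightarrow> ('h \<Rightarrow> 's measure) \<Rightarrow> bool" where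
  "regular_cond_law M N H S X \<kappa> \<longleftrightarrow>
     H \<in> M \<rightarrow>\<^sub>M N \<and> X \<in> M \<rightarrow>\<^sub>M S \<and> \<kappa> \<in> N \<rightarrow>\<^sub>M prob_algebra S \<and>
     (\<forall>B\<in>sets S. AE \<omega> in M.
        measure (\<kappa> (H \<omega>)) B = cond_exp_given M N H (\<lambda>\<omega>. indicator B (X \<omega>)) \<omega>)"

definition cond_indep ::
  "'w measure \<Rightarrow> 'h measure \<Rightarrow> ('w \<Rightarrow> 'h) \<Rightarrow> 's measure \<Rightarrow> ('w \<Rightarrow> 's) \<Rightarrow> 't measure \<Rightarrow> ('w \<Rightarrow> 't) \<Rightarrow> bool" where
  "cond_indep M N H S X T Y \<longleftrightarrow>
     H \<in> M \<rightarrow>\<^sub>M N \<and> X \<in> M \<rightarrow>\<^sub>M S \<and> Y \<in> M \<rightarrow>\<^sub>M T \<and>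
     (\<forall>B\<in>sets S. \<forall>C\<in>sets T. AE \<omega> in M.
        cond_exp_given M N H (\<lambda>\<omega>. indicator B (X \<omega>) * indicator C (Y \<omega>)) \<omega> =
        cond_exp_given M N H (\<lambda>\<omega>. indicator B (X \<omega>)) \<omega> *
        cond_exp_given M N H (\<lambda>\<omega>. indicator C (Y \<omega>)) \<omega>)"

text \<open>A chosen version of the conditional law. On a standard Borel space \<open>S\<close> a version exists, and
  since its \<open>\<sigma>\<close>-algebra is countably generated, two versions agree at \<open>H \<omega>\<close> for almost every \<open>\<omega>\<close>.\<close>

definition cond_law ::
  "'w measure \<Rightarrow> 'h measure \<Rightarrow> ('w \<Rightarrow> 'h) \<Rightarrow> 's measure \<Rightarrow> ('w \<Rightarrow> 's) \<Rightarrow> 'h \<Rightarrow> 's measure" where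
  "cond_law M N H S X = (SOME \<kappa>. regular_cond_law M N H S X \<kappa>)"

text \<open>The mutual information of \<open>X\<close> and \<open>Y\<close> under their joint conditional law at the realized value
  of \<open>H\<close>, in nats: a random variable, not its average over \<open>H\<close>
  (the library's \<open>conditional_mutual_information\<close> is the average).
  The Bochner integral inside the library's \<open>mutual_information\<close> is never a junk value when \<open>X\<close>
  takes finitely many values, the only case needed below: the joint law then has a bounded density
  with respect to the product of the marginals.\<close>

definition mutual_information_given ::
  "'w measure \<Rightarrow> 'h measure \<Rightarrow> ('w \<Rightarrow> 'h) \<Rightarrow> 's measure \<Rightarrow> 't measure \<Rightarrow>
   ('w \<Rightarrow> 's) \<Rightarrow> ('w \<Rightarrow> 't) \<Rightarrow> 'w \<Rightarrow> real" where
  "mutual_information_given M N H S T X Y \<omega> =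
     prob_space.mutual_information
       (cond_law M N H (S \<Otimes>\<^sub>M T) (\<lambda>\<omega>. (X \<omega>, Y \<omega>)) (H \<omega>)) (exp 1) S T fst snd"


section \<open>Bayesian bandits and Thompson sampling\<close>

text \<open>The random reward function is \<open>R a \<theta> x\<close>, where \<open>x\<close> is the reward noise, so that the reward law
  given action \<open>a\<close> and parameter \<open>\<theta>\<close> is the law of \<open>R a \<theta>\<close> under \<open>noise\<close> (every kernel to the reals
  has this form). In round \<open>t\<close> the noise is \<open>\<xi> t\<close>. The parameter set is \<open>space prior\<close>.
  The history before round \<open>t\<close> is the tuple of the action-reward pairs of rounds \<open>1, \<dots>, t - 1\<close>.\<close>

definition hist_space :: "'a::topological_space set \<Rightarrow> nat \<Rightarrow> (nat \<Rightarrow> 'a \<times> real) measure" where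
  "hist_space acts t = (\<Pi>\<^sub>M i\<in>{1..<t}. restrict_space borel acts \<Otimes>\<^sub>M borel)"

definition hist ::
  "('a \<Rightarrow> 'o \<Rightarrow> 'n \<Rightarrow> real) \<Rightarrow> ('w \<Rightarrow> 'o) \<Rightarrow> (nat \<Rightarrow> 'w \<Rightarrow> 'n) \<Rightarrow> (nat \<Rightarrow> 'w \<Rightarrow> 'a) \<Rightarrow>
   nat \<Rightarrow> 'w \<Rightarrow> nat \<Rightarrow> 'a \<times> real" where
  "hist R \<Theta> \<xi> A t \<omega> = (\<lambda>i\<in>{1..<t}. (A i \<omega>, R (A i \<omega>) (\<Theta> \<omega>) (\<xi> i \<omega>)))"

locale bayesian_bandit = prob_space M
  for M :: "'w measure" +
  fixes acts :: "'a::metric_space set"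
    and prior :: "'o measure"
    and noise :: "'n measure"
    and R :: "'a \<Rightarrow> 'o \<Rightarrow> 'n \<Rightarrow> real"
    and opt :: "'o \<Rightarrow> 'a"
    and \<Theta> :: "'w \<Rightarrow> 'o"
    and \<xi> :: "nat \<Rightarrow> 'w \<Rightarrow> 'n"
    and A :: "nat \<Rightarrow> 'w \<Rightarrow> 'a"
    and T :: nat
  assumes horizon: "1 \<le> T"
    and compact_acts: "compact acts"
    and prob_space_prior: "prob_space prior"
    and prob_space_noise: "prob_space noise"
    and measurable_R:
      "(\<lambda>(a, \<theta>, x). R a \<theta> x) \<in> restrict_space borel acts \<Otimes>\<^sub>M prior \<Otimes>\<^sub>M noise \<rightarrow>\<^sub>M borel"
    and integrable_R: "\<And>a \<theta>. a \<in> acts \<Longrightarrow> \<theta> \<in> space prior \<Longrightarrow> integrable noise (R a \<theta>)"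
    and opt_arg_max:
      "\<And>\<theta>. \<theta> \<in> space prior \<Longrightarrow> is_arg_max (\<lambda>a. \<integral>x. R a \<theta> x \<partial>noise) (\<lambda>a. a \<in> acts) (opt \<theta>)"
    and opt_bij: "bij_betw opt (space prior) acts"
    and measurable_opt: "opt \<in> prior \<rightarrow>\<^sub>M restrict_space borel acts"
    and measurable_opt_inv: "inv_into (space prior) opt \<in> restrict_space borel acts \<rightarrow>\<^sub>M prior"
    and measurable_\<Theta>: "\<Theta> \<in> M \<rightarrow>\<^sub>M prior"
    and distr_\<Theta>: "distr M prior \<Theta> = prior"
    and measurable_noise: "\<And>t. t \<in> {1..T} \<Longrightarrow> \<xi> t \<in> M \<rightarrow>\<^sub>M noise"
    and distr_noise: "\<And>t. t \<in> {1..T} \<Longrightarrow> distr M noise (\<xi> t) = noise"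
    \<comment> \<open>\<open>indep_var\<close> would force both variables to have the same type of values\<close>
    and indep_noise: "\<And>t. t \<in> {1..T} \<Longrightarrow>
      indep_set
        (sets (vimage_algebra (space M) (\<lambda>\<omega>. (hist R \<Theta> \<xi> A t \<omega>, \<Theta> \<omega>, A t \<omega>))
          (hist_space acts t \<Otimes>\<^sub>M prior \<Otimes>\<^sub>M restrict_space borel acts)))
        (sets (vimage_algebra (space M) (\<xi> t) noise))"
    and action_cond_indep: "\<And>t. t \<in> {1..T} \<Longrightarrow>
      cond_indep M (hist_space acts t) (hist R \<Theta> \<xi> A t) prior \<Theta> (restrict_space borel acts) (A t)"

locale thompson_sampling = bayesian_bandit M acts prior noise R opt \<Theta> \<xi> A T
  for M :: "'w measure"
    and acts :: "'a::metric_space set"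
    and prior :: "'o measure"
    and noise :: "'n measure"
    and R :: "'a \<Rightarrow> 'o \<Rightarrow> 'n \<Rightarrow> real"
    and opt :: "'o \<Rightarrow> 'a"
    and \<Theta> :: "'w \<Rightarrow> 'o"
    and \<xi> :: "nat \<Rightarrow> 'w \<Rightarrow> 'n"
    and A :: "nat \<Rightarrow> 'w \<Rightarrow> 'a"
    and T :: nat +
  fixes posterior :: "nat \<Rightarrow> (nat \<Rightarrow> 'a \<times> real) \<Rightarrow> 'o measure"
    and \<Theta>s :: "nat \<Rightarrow> 'w \<Rightarrow> 'o"
  assumes posterior: "\<And>t. t \<in> {1..T} \<Longrightarrow>
      regular_cond_law M (hist_space acts t) (hist R \<Theta> \<xi> A t) prior \<Theta> (posterior t)"
    and sample_law: "\<And>t. t \<in> {1..T} \<Longrightarrow>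
      regular_cond_law M (hist_space acts t) (hist R \<Theta> \<xi> A t) prior (\<Theta>s t) (posterior t)"
    and sample_cond_indep: "\<And>t. t \<in> {1..T} \<Longrightarrow>
      cond_indep M (hist_space acts t) (hist R \<Theta> \<xi> A t) prior \<Theta> prior (\<Theta>s t)"
    and action_eq: "\<And>t \<omega>. t \<in> {1..T} \<Longrightarrow> \<omega> \<in> space M \<Longrightarrow> A t \<omega> = opt (\<Theta>s t \<omega>)"


section \<open>Compression of the action set\<close>

definition cell_index :: "nat \<Rightarrow> (nat \<Rightarrow> 'a set) \<Rightarrow> 'a \<Rightarrow> nat" where
  "cell_index K cell a = (THE k. k \<in> {1..K} \<and> a \<in> cell k)"

text \<open>Division on \<open>ennreal\<close> gives \<open>0 / 0 = 0\<close>, and \<open>x / 0 = \<infinity>\<close> for \<open>x > 0\<close>.\<close>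

definition information_ratio :: "real \<Rightarrow> real \<Rightarrow> ennreal" where
  "information_ratio d i = ennreal (d\<^sup>2) / ennreal i"

end

theory Submission
  imports Defs
begin

text \<open>Let \<open>d\<^sub>t = E\<^sub>t [R(compressed optimum) - R(compressed TS action)]\<close>. Condition 1 bounds the regret by
  \<open>\<epsilon> T + \<Sum> E d\<^sub>t\<close>, and Cauchy--Schwarz bounds \<open>\<Sum> E d\<^sub>t\<close> by the root of the summed information ratios
  times the summed mutual informations. By condition 2, replacing the compressed information in the
  denominator by \<open>I\<^sub>t (A\<^sup>\<star>\<^sub>\<epsilon>; A\<^sub>t, R(A\<^sub>t))\<close> only decreases the ratio. Since \<open>(A\<^sub>t, R(A\<^sub>t))\<close> is exactly what
  is appended to the history, these informations telescope:
  \<open>E I\<^sub>t = H(A\<^sup>\<star>\<^sub>\<epsilon> | H\<^sup>t) - H(A\<^sup>\<star>\<^sub>\<epsilon> | H\<^sup>t\<^sup>+\<^sup>1)\<close>, with sum at most \<open>H(A\<^sup>\<star>\<^sub>\<epsilon>)\<close>.\<close>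


text \<open>The compressed information enters only through condition 2: \<open>cond_law\<close> is a
  Hilbert choice, and no version of it is built for the compressed action. The analysis concerns the
  pair actually played, whose conditional law is assembled from posterior and noise. Three obstacles
  shape the rest. Identities for a conditional law hold off a null set that depends on the event,
  while mutual information needs the whole law at one \<omega>; compactness makes the algebra of
  action-reward pairs countably generated, so a single null set suffices. Measurability of mutual
  information as a function of \<omega> is not visible from its definition; an integrable
  \<open>J\<close> that agrees with it almost everywhere takes its place. Finally, telescoping must
  identify conditioning on the next history with conditioning on the old history and the new pair.
  Entropies are therefore written through conditional probabilities of the finitely many cells:
  these depend only on the generated algebra, and their bounded terms make every difference of
  entropies finite.\<close>

section \<open>Conditional expectations\<close>

context prob_space
begin

lemma subalgebra_vimage:
  assumes "H \<in> M \<rightarrow>\<^sub>M N"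
  shows "subalgebra M (vimage_algebra (space M) H N)"
  using sets_image_in_sets[OF refl assms] by (simp add: subalgebra_def)

lemma sigma_finite_subalgebra_vimage:
  assumes "H \<in> M \<rightarrow>\<^sub>M N"
  shows "sigma_finite_subalgebra M (vimage_algebra (space M) H N)"
proof -
  interpret finite_measure_subalgebra M "vimage_algebra (space M) H N"
    by (simp add: finite_measure_subalgebra_axioms_def finite_measure_subalgebra_def
        finite_measure_axioms subalgebra_vimage[OF assms])
  show ?thesis ..
qed

lemma measurable_cond_exp_given [measurable]: "cond_exp_given M N H f \<in> borel_measurable M"
  unfolding cond_exp_given_def by (rule borel_measurable_cond_exp2)

lemma integral_cond_exp_given:
  assumes H: "H \<in> M \<rightarrow>\<^sub>M N" and f: "integrable M f"
  shows "integrable M (cond_exp_given M N H f)"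
    "(\<integral>\<omega>. cond_exp_given M N H f \<omega> \<partial>M) = (\<integral>\<omega>. f \<omega> \<partial>M)"
proof -
  interpret sigma_finite_subalgebra M "vimage_algebra (space M) H N"
    by (rule sigma_finite_subalgebra_vimage[OF H])
  show "integrable M (cond_exp_given M N H f)"
    "(\<integral>\<omega>. cond_exp_given M N H f \<omega> \<partial>M) = (\<integral>\<omega>. f \<omega> \<partial>M)"
    using real_cond_exp_int[OF f] by (simp_all add: cond_exp_given_def)
qed

lemma integral_indicator_cond_exp_given:
  assumes H: "H \<in> M \<rightarrow>\<^sub>M N" and f: "integrable M f" and D: "D \<in> sets N"
  shows "(\<integral>\<omega>. indicator D (H \<omega>) * cond_exp_given M N H f \<omega> \<partial>M) =
    (\<integral>\<omega>. indicator D (H \<omega>) * f \<omega> \<partial>M)"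
proof -
  interpret sigma_finite_subalgebra M "vimage_algebra (space M) H N"
    by (rule sigma_finite_subalgebra_vimage[OF H])
  have [measurable]: "H \<in> vimage_algebra (space M) H N \<rightarrow>\<^sub>M N"
    using H by (intro measurable_vimage_algebra1) (auto dest: measurable_space)
  note [measurable] = H D
  have "integrable M (\<lambda>\<omega>. indicator D (H \<omega>) * f \<omega>)"
    by (rule Bochner_Integration.integrable_bound[OF f]) (use f in \<open>auto split: split_indicator\<close>)
  then show ?thesis
    unfolding cond_exp_given_def using f
    by (intro real_cond_exp_intg(2)) (auto simp: borel_measurable_integrable)
qed

lemma cond_exp_given_eqI:
  assumes H: "H \<in> M \<rightarrow>\<^sub>M N" and f: "integrable M f"
    and g: "g \<in> borel_measurable N" "integrable M (\<lambda>\<omega>. g (H \<omega>))"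
    and eq: "\<And>D. D \<in> sets N \<Longrightarrow>
      (\<integral>\<omega>. indicator D (H \<omega>) * f \<omega> \<partial>M) = (\<integral>\<omega>. indicator D (H \<omega>) * g (H \<omega>) \<partial>M)"
  shows "AE \<omega> in M. cond_exp_given M N H f \<omega> = g (H \<omega>)"
proof -
  interpret sigma_finite_subalgebra M "vimage_algebra (space M) H N"
    by (rule sigma_finite_subalgebra_vimage[OF H])
  have H_sp: "H \<in> space M \<rightarrow> space N"
    using H by (auto dest: measurable_space)
  have [measurable]: "H \<in> vimage_algebra (space M) H N \<rightarrow>\<^sub>M N"
    using H_sp by (intro measurable_vimage_algebra1) 
  show ?thesis
    unfolding cond_exp_given_def
  proof (rule real_cond_exp_charact)
    fix B assume "B \<in> sets (vimage_algebra (space M) H N)"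
    then obtain D where D: "D \<in> sets N" "B = H -` D \<inter> space M"
      using H_sp by (auto simp: sets_vimage_algebra2)
    have "set_lebesgue_integral M B u = (\<integral>\<omega>. indicator D (H \<omega>) * u \<omega> \<partial>M)" for u :: "'a \<Rightarrow> real"
      unfolding set_lebesgue_integral_def
      by (rule Bochner_Integration.integral_cong) (auto simp: D split: split_indicator)
    then show "set_lebesgue_integral M B f = set_lebesgue_integral M B (\<lambda>\<omega>. g (H \<omega>))"
      using eq[OF D(1)] by simp
  qed (use f g in measurable)
qed

lemma cond_exp_given_bounds:
  assumes H: "H \<in> M \<rightarrow>\<^sub>M N" and f: "f \<in> borel_measurable M"
    and bnd: "\<And>\<omega>. \<omega> \<in> space M \<Longrightarrow> 0 \<le> f \<omega> \<and> f \<omega> \<le> 1"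
  shows "AE \<omega> in M. 0 \<le> cond_exp_given M N H f \<omega> \<and> cond_exp_given M N H f \<omega> \<le> 1"
proof -
  interpret sigma_finite_subalgebra M "vimage_algebra (space M) H N"
    by (rule sigma_finite_subalgebra_vimage[OF H])
  have f': "integrable M f"
    by (rule integrable_const_bound[where B=1]) (use f bnd in auto)
  have "AE \<omega> in M. 0 \<le> cond_exp_given M N H f \<omega>" "AE \<omega> in M. cond_exp_given M N H f \<omega> \<le> 1"
    unfolding cond_exp_given_def
    using real_cond_exp_ge_c[OF f', of 0] real_cond_exp_le_c[OF f', of 1] bnd by auto
  then show ?thesis by auto
qed

text \<open>The Doob--Dynkin factorisation: the infimum of the rationals \<open>q\<close> with \<open>x \<in> D q\<close> recovers \<open>h\<close>, where
  \<open>h < q\<close> holds exactly on \<open>X -` D q\<close>.\<close>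

lemma cond_exp_given_factorises:
  assumes X: "X \<in> M \<rightarrow>\<^sub>M L" and f: "f \<in> borel_measurable M"
    and bnd: "\<And>\<omega>. \<omega> \<in> space M \<Longrightarrow> 0 \<le> f \<omega> \<and> f \<omega> \<le> 1"
  obtains g :: "'b \<Rightarrow> real" where "g \<in> borel_measurable L" "\<And>x. 0 \<le> g x" "\<And>x. g x \<le> 1"
    "AE \<omega> in M. cond_exp_given M L X f \<omega> = g (X \<omega>)"
proof -
  define h where "h = cond_exp_given M L X f"
  let ?V = "vimage_algebra (space M) X L"
  have h: "h \<in> borel_measurable ?V"
    unfolding h_def cond_exp_given_def by (rule borel_measurable_cond_exp)
  have X_sp: "X \<in> space M \<rightarrow> space L"
    using X by (auto dest: measurable_space)
  have "\<exists>D\<in>sets L. {\<omega>\<in>space M. h \<omega> < real_of_rat q} = X -` D \<inter> space M" for q :: rat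
  proof -
    have "{\<omega>\<in>space ?V. h \<omega> < real_of_rat q} \<in> sets ?V"
      using h by measurable
    then show ?thesis
      using X_sp by (auto simp: sets_vimage_algebra2)
  qed
  then obtain D :: "rat \<Rightarrow> 'b set" where D[measurable]: "\<And>q. D q \<in> sets L"
    and D_eq: "\<And>q. {\<omega>\<in>space M. h \<omega> < real_of_rat q} = X -` D q \<inter> space M"
    by metis
  \<comment> \<open>The value infinity off \<open>D q\<close> removes \<open>q\<close> from the
    infimum. Extended reals keep the infimum meaningful at points outside the range of
    \<open>X\<close>.\<close>
  define g0 :: "'b \<Rightarrow> ereal" where "g0 x = (INF q. if x \<in> D q then ereal (real_of_rat q) else \<infinity>)" for x
  have [measurable]: "g0 \<in> borel_measurable L"
    unfolding g0_def[abs_def] by measurable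
  have g0: "g0 (X \<omega>) = ereal (h \<omega>)" if "\<omega> \<in> space M" for \<omega>
  proof (rule antisym)
    have mem: "X \<omega> \<in> D q \<longleftrightarrow> h \<omega> < real_of_rat q" for q
      using D_eq[of q] that by auto
    show "ereal (h \<omega>) \<le> g0 (X \<omega>)"
      unfolding g0_def by (rule INF_greatest) (auto simp: mem)
    show "g0 (X \<omega>) \<le> ereal (h \<omega>)"
    proof (rule dense_ge)
      fix y assume y: "ereal (h \<omega>) < y"
      then obtain r where r: "ereal (h \<omega>) < ereal r" "ereal r < y"
        using ereal_dense2 by blast
      obtain q where q: "h \<omega> < real_of_rat q" "real_of_rat q < r"
        using of_rat_dense r(1) by auto
      have "ereal (real_of_rat q) < y"
        using q(2) r(2) less_trans[of "ereal (real_of_rat q)" "ereal r" y] by simp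
      have "g0 (X \<omega>) \<le> (if X \<omega> \<in> D q then ereal (real_of_rat q) else \<infinity>)"
        unfolding g0_def by (rule INF_lower) simp
      also have "\<dots> \<le> y"
        using q(1) \<open>ereal (real_of_rat q) < y\<close> by (simp add: mem)
      finally show "g0 (X \<omega>) \<le> y" .
    qed
  qed
  \<comment> \<open>Clipping enforces the bounds everywhere, also off the range of \<open>X\<close>,
    where \<open>g0\<close> may be infinite; on the range it changes the value only on a null
    set.\<close>
  define g where "g x = max 0 (min 1 (real_of_ereal (g0 x)))" for x
  show thesis
  proof
    show "g \<in> borel_measurable L"
      unfolding g_def[abs_def] by measurable
    have "AE \<omega> in M. 0 \<le> cond_exp_given M L X f \<omega> \<and> cond_exp_given M L X f \<omega> \<le> 1"
      using cond_exp_given_bounds[OF X f] bnd by blast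
    then show "AE \<omega> in M. cond_exp_given M L X f \<omega> = g (X \<omega>)"
      using AE_space
      by eventually_elim (auto simp: g_def g0 h_def[symmetric])
  qed (auto simp: g_def)
qed

text \<open>Both functions are densities, with respect to the law of \<open>H\<close>, of one and
  the same measure, and densities over a finite measure are unique almost everywhere. Infinite
  values are allowed.\<close>

lemma AE_eq_compose:
  fixes u v :: "'b \<Rightarrow> ennreal"
  assumes H: "H \<in> M \<rightarrow>\<^sub>M N"
    and u: "u \<in> borel_measurable N" and v: "v \<in> borel_measurable N"
    and eq: "\<And>D. D \<in> sets N \<Longrightarrow>
      (\<integral>\<^sup>+\<omega>. indicator D (H \<omega>) * u (H \<omega>) \<partial>M) = (\<integral>\<^sup>+\<omega>. indicator D (H \<omega>) * v (H \<omega>) \<partial>M)"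
  shows "AE \<omega> in M. u (H \<omega>) = v (H \<omega>)"
proof -
  note [measurable] = H u v
  interpret D: prob_space "distr M N H"
    by (rule prob_space_distr[OF H])
  have "AE h in distr M N H. u h = v h"
  proof (rule D.density_unique_finite_measure)
    fix A assume "A \<in> sets (distr M N H)"
    then have [measurable]: "A \<in> sets N" by simp
    show "(\<integral>\<^sup>+x. u x * indicator A x \<partial>distr M N H) = (\<integral>\<^sup>+x. v x * indicator A x \<partial>distr M N H)"
      using eq[of A] by (simp add: nn_integral_distr mult.commute)
  qed auto
  then show ?thesis
    by (subst (asm) AE_distr_iff) auto
qed

end


section \<open>Regular conditional laws\<close>

lemma kernel_simps:
  assumes "\<kappa> \<in> N \<rightarrow>\<^sub>M prob_algebra S" "h \<in> space N"
  shows "prob_space (\<kappa> h)" "sets (\<kappa> h) = sets S" "space (\<kappa> h) = space S"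
  using measurable_space[OF assms] by (auto simp: space_prob_algebra dest: sets_eq_imp_space_eq)

lemma measurable_emeasure_kernel_prob [measurable (raw)]:
  assumes "\<kappa> \<in> N \<rightarrow>\<^sub>M prob_algebra S" "B \<in> sets S"
  shows "(\<lambda>h. emeasure (\<kappa> h) B) \<in> borel_measurable N"
  using assms by (intro measurable_emeasure_kernel[OF measurable_prob_algebraD])

context prob_space
begin

text \<open>Nonnegative integrals over events of \<open>H\<close> replace conditional expectations,
  so that later kernels are verified by computation in \<open>ennreal\<close> without integrability
  side conditions.\<close>

lemma regular_cond_lawI:
  assumes H: "H \<in> M \<rightarrow>\<^sub>M N" and X: "X \<in> M \<rightarrow>\<^sub>M S" and \<kappa>: "\<kappa> \<in> N \<rightarrow>\<^sub>M prob_algebra S"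
    and eq: "\<And>D B. D \<in> sets N \<Longrightarrow> B \<in> sets S \<Longrightarrow>
      (\<integral>\<^sup>+\<omega>. indicator D (H \<omega>) * indicator B (X \<omega>) \<partial>M) =
      (\<integral>\<^sup>+\<omega>. indicator D (H \<omega>) * emeasure (\<kappa> (H \<omega>)) B \<partial>M)"
  shows "regular_cond_law M N H S X \<kappa>"
  unfolding regular_cond_law_def
proof (intro conjI ballI H X \<kappa>)
  fix B assume B: "B \<in> sets S"
  note [measurable] = H X \<kappa> B
  have P: "prob_space (\<kappa> (H \<omega>))" if "\<omega> \<in> space M" for \<omega>
    using kernel_simps[OF \<kappa>] measurable_space[OF H that] by simp
  have meas: "(\<lambda>h. measure (\<kappa> h) B) \<in> borel_measurable N"
    unfolding measure_def by measurable
  note [measurable] = measurable_compose[OF H meas]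
  have "AE \<omega> in M. cond_exp_given M N H (\<lambda>\<omega>. indicator B (X \<omega>)) \<omega> = measure (\<kappa> (H \<omega>)) B"
  proof (rule cond_exp_given_eqI[OF H _ meas])
    show "integrable M (\<lambda>\<omega>. indicator B (X \<omega>) :: real)"
      by (rule integrable_const_bound[where B=1]) auto
    show "integrable M (\<lambda>\<omega>. measure (\<kappa> (H \<omega>)) B)"
      by (rule integrable_const_bound[where B=1])
        (use P in \<open>auto simp: prob_space.prob_le_1\<close>)
    fix D assume [measurable]: "D \<in> sets N"
    have "(\<integral>\<omega>. indicator D (H \<omega>) * indicator B (X \<omega>) \<partial>M) =
        enn2real (\<integral>\<^sup>+\<omega>. indicator D (H \<omega>) * indicator B (X \<omega>) \<partial>M)"
      by (subst integral_eq_nn_integral)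
        (auto intro!: arg_cong[where f=enn2real] nn_integral_cong split: split_indicator)
    also have "\<dots> = enn2real (\<integral>\<^sup>+\<omega>. indicator D (H \<omega>) * emeasure (\<kappa> (H \<omega>)) B \<partial>M)"
      by (simp add: eq B)
    also have "\<dots> = (\<integral>\<omega>. indicator D (H \<omega>) * measure (\<kappa> (H \<omega>)) B \<partial>M)"
      by (subst integral_eq_nn_integral)
        (auto intro!: arg_cong[where f=enn2real] nn_integral_cong split: split_indicator
          simp: finite_measure.emeasure_eq_measure[OF prob_space.finite_measure[OF P]])
    finally show "(\<integral>\<omega>. indicator D (H \<omega>) * indicator B (X \<omega>) \<partial>M) =
      (\<integral>\<omega>. indicator D (H \<omega>) * measure (\<kappa> (H \<omega>)) B \<partial>M)" .
  qed
  then show "AE \<omega> in M. measure (\<kappa> (H \<omega>)) B = cond_exp_given M N H (\<lambda>\<omega>. indicator B (X \<omega>)) \<omega>"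
    by eventually_elim simp
qed

lemma regular_cond_lawD:
  assumes rcl: "regular_cond_law M N H S X \<kappa>"
  shows "H \<in> M \<rightarrow>\<^sub>M N" "X \<in> M \<rightarrow>\<^sub>M S" "\<kappa> \<in> N \<rightarrow>\<^sub>M prob_algebra S"
    and "B \<in> sets S \<Longrightarrow>
      AE \<omega> in M. cond_exp_given M N H (\<lambda>\<omega>. indicator B (X \<omega>)) \<omega> = measure (\<kappa> (H \<omega>)) B"
  using assms by (auto simp: regular_cond_law_def eq_commute)

text \<open>The bridge from real conditional expectations to nonnegative integrals. It passes
  through the Bochner integral, where the bounds on \<open>f\<close> supply integrability;
  \<open>g\<close> is any version known almost everywhere.\<close>

lemma cond_exp_given_nn_integral:
  assumes H: "H \<in> M \<rightarrow>\<^sub>M N" and D: "D \<in> sets N" and f: "f \<in> borel_measurable M"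
    and bnd: "\<And>\<omega>. \<omega> \<in> space M \<Longrightarrow> 0 \<le> f \<omega> \<and> f \<omega> \<le> 1"
    and ae: "AE \<omega> in M. cond_exp_given M N H f \<omega> = g \<omega>"
  shows "(\<integral>\<^sup>+\<omega>. indicator D (H \<omega>) * ennreal (f \<omega>) \<partial>M) = (\<integral>\<^sup>+\<omega>. indicator D (H \<omega>) * ennreal (g \<omega>) \<partial>M)"
proof -
  note [measurable] = H D f
  let ?c = "cond_exp_given M N H f"
  have f': "integrable M f"
    by (rule integrable_const_bound[where B=1]) (use bnd in auto)
  have c: "AE \<omega> in M. 0 \<le> ?c \<omega>" 
    using cond_exp_given_bounds[OF H f bnd] by auto
  have "(\<integral>\<^sup>+\<omega>. indicator D (H \<omega>) * ennreal (f \<omega>) \<partial>M) =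
      (\<integral>\<^sup>+\<omega>. ennreal (indicator D (H \<omega>) * f \<omega>) \<partial>M)"
    by (intro nn_integral_cong) (auto split: split_indicator)
  also have "\<dots> = ennreal (\<integral>\<omega>. indicator D (H \<omega>) * f \<omega> \<partial>M)"
    by (rule nn_integral_eq_integral)
      (use bnd in \<open>auto intro!: Bochner_Integration.integrable_bound[OF f'] split: split_indicator\<close>)
  also have "\<dots> = ennreal (\<integral>\<omega>. indicator D (H \<omega>) * ?c \<omega> \<partial>M)"
    by (simp add: integral_indicator_cond_exp_given[OF H f' D])
  also have "\<dots> = (\<integral>\<^sup>+\<omega>. ennreal (indicator D (H \<omega>) * ?c \<omega>) \<partial>M)"
    by (rule nn_integral_eq_integral[symmetric])
      (use c in \<open>auto intro!: Bochner_Integration.integrable_bound[OF integral_cond_exp_given(1)[OF H f']]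
        split: split_indicator\<close>)
  also have "\<dots> = (\<integral>\<^sup>+\<omega>. indicator D (H \<omega>) * ennreal (g \<omega>) \<partial>M)"
    by (rule nn_integral_cong_AE) (use ae in \<open>eventually_elim, auto split: split_indicator\<close>)
  finally show ?thesis .
qed

text \<open>Converse of \<open>regular_cond_lawI\<close>.\<close>

lemma regular_cond_law_rectangle:
  assumes rcl: "regular_cond_law M N H S X \<kappa>" and D: "D \<in> sets N" and B: "B \<in> sets S"
  shows "(\<integral>\<^sup>+\<omega>. indicator D (H \<omega>) * indicator B (X \<omega>) \<partial>M) =
      (\<integral>\<^sup>+\<omega>. indicator D (H \<omega>) * emeasure (\<kappa> (H \<omega>)) B \<partial>M)"
proof -
  note rcl' = regular_cond_lawD[OF rcl]
  note [measurable] = rcl'(1,2) D B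
  have P: "prob_space (\<kappa> (H \<omega>))" if "\<omega> \<in> space M" for \<omega>
    using kernel_simps[OF rcl'(3)] measurable_space[OF rcl'(1) that] by simp
  have "(\<integral>\<^sup>+\<omega>. indicator D (H \<omega>) * indicator B (X \<omega>) \<partial>M) =
    (\<integral>\<^sup>+\<omega>. indicator D (H \<omega>) * ennreal (indicator B (X \<omega>)) \<partial>M)"
    by (simp add: ennreal_indicator)
  also have "\<dots> = (\<integral>\<^sup>+\<omega>. indicator D (H \<omega>) * ennreal (measure (\<kappa> (H \<omega>)) B) \<partial>M)"
    by (rule cond_exp_given_nn_integral[OF rcl'(1) D _ _ rcl'(4)[OF B]]) auto
  also have "\<dots> = (\<integral>\<^sup>+\<omega>. indicator D (H \<omega>) * emeasure (\<kappa> (H \<omega>)) B \<partial>M)"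
    by (intro nn_integral_cong)
      (simp add: finite_measure.emeasure_eq_measure[OF prob_space.finite_measure[OF P]])
  finally show ?thesis .
qed

text \<open>Dynkin's pi-lambda argument in \<open>B\<close> with \<open>D\<close> fixed.
  Independence hypotheses control rectangles only, and this lets them determine a kernel on a
  product space.\<close>

lemma regular_cond_lawI_generator:
  assumes H: "H \<in> M \<rightarrow>\<^sub>M N" and X: "X \<in> M \<rightarrow>\<^sub>M S" and \<kappa>: "\<kappa> \<in> N \<rightarrow>\<^sub>M prob_algebra S"
    and G: "Int_stable G" "G \<subseteq> Pow (space S)" "sets S = sigma_sets (space S) G"
    and eq: "\<And>D B. D \<in> sets N \<Longrightarrow> B \<in> G \<Longrightarrow>
      (\<integral>\<^sup>+\<omega>. indicator D (H \<omega>) * indicator B (X \<omega>) \<partial>M) =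
      (\<integral>\<^sup>+\<omega>. indicator D (H \<omega>) * emeasure (\<kappa> (H \<omega>)) B \<partial>M)"
  shows "regular_cond_law M N H S X \<kappa>"
proof (rule regular_cond_lawI[OF H X \<kappa>])
  fix D B assume D: "D \<in> sets N" and B: "B \<in> sets S"
  have P: "prob_space (\<kappa> (H \<omega>))" "space (\<kappa> (H \<omega>)) = space S" "sets (\<kappa> (H \<omega>)) = sets S"
    if "\<omega> \<in> space M" for \<omega>
    using kernel_simps[OF \<kappa>] measurable_space[OF H that] by simp_all
  note [measurable] = H X D \<kappa>
  show "(\<integral>\<^sup>+\<omega>. indicator D (H \<omega>) * indicator B (X \<omega>) \<partial>M) =
      (\<integral>\<^sup>+\<omega>. indicator D (H \<omega>) * emeasure (\<kappa> (H \<omega>)) B \<partial>M)"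
    using G(1,2) B[unfolded G(3)]
  proof (induction rule: sigma_sets_induct_disjoint)
    case (basic B)
    then show ?case using eq D by simp
  next
    case empty
    then show ?case by simp
  next
    case (compl B)
    then have [measurable]: "B \<in> sets S" by (simp add: G(3))
    \<comment> \<open>The complement is reached by cancelling this summand, which in
      \<open>ennreal\<close> is legitimate only if it is finite.\<close>
    have fin: "(\<integral>\<^sup>+\<omega>. indicator D (H \<omega>) * indicator B (X \<omega>) \<partial>M) \<noteq> \<infinity>"
    proof -
      have "(\<integral>\<^sup>+\<omega>. indicator D (H \<omega>) * indicator B (X \<omega>) \<partial>M) \<le> (\<integral>\<^sup>+\<omega>. 1 \<partial>M)"
        by (intro nn_integral_mono) (auto split: split_indicator)
      then show ?thesis by (auto simp: emeasure_space_1 top_unique)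
    qed
    have "(\<integral>\<^sup>+\<omega>. indicator D (H \<omega>) * indicator (space S - B) (X \<omega>) \<partial>M) +
        (\<integral>\<^sup>+\<omega>. indicator D (H \<omega>) * indicator B (X \<omega>) \<partial>M) = (\<integral>\<^sup>+\<omega>. indicator D (H \<omega>) \<partial>M)"
      using measurable_space[OF X]
      by (subst nn_integral_add[symmetric]) (auto intro!: nn_integral_cong split: split_indicator)
    moreover have "(\<integral>\<^sup>+\<omega>. indicator D (H \<omega>) * emeasure (\<kappa> (H \<omega>)) (space S - B) \<partial>M) +
        (\<integral>\<^sup>+\<omega>. indicator D (H \<omega>) * emeasure (\<kappa> (H \<omega>)) B \<partial>M) = (\<integral>\<^sup>+\<omega>. indicator D (H \<omega>) \<partial>M)"
    proof -
      have "emeasure (\<kappa> (H \<omega>)) (space S - B) + emeasure (\<kappa> (H \<omega>)) B = 1" if "\<omega> \<in> space M" for \<omega>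
        using P[OF that] prob_space.emeasure_space_1[OF P(1)[OF that]] sets.sets_into_space[OF \<open>B \<in> sets S\<close>]
        by (subst plus_emeasure) (auto simp: Un_absorb1 Un_commute)
      then show ?thesis
        by (subst nn_integral_add[symmetric])
          (auto intro!: nn_integral_cong simp: distrib_left[symmetric] split: split_indicator)
    qed
    ultimately have "(\<integral>\<^sup>+\<omega>. indicator D (H \<omega>) * indicator B (X \<omega>) \<partial>M) +
        (\<integral>\<^sup>+\<omega>. indicator D (H \<omega>) * indicator (space S - B) (X \<omega>) \<partial>M) =
        (\<integral>\<^sup>+\<omega>. indicator D (H \<omega>) * indicator B (X \<omega>) \<partial>M) +
        (\<integral>\<^sup>+\<omega>. indicator D (H \<omega>) * emeasure (\<kappa> (H \<omega>)) (space S - B) \<partial>M)"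
      by (simp add: compl.IH add.commute)
    then show ?case
      using fin by (simp add: ennreal_add_left_cancel)
  next
    case (union B)
    then have [measurable]: "\<And>i. B i \<in> sets S" by (auto simp: G(3))
    have "(\<integral>\<^sup>+\<omega>. indicator D (H \<omega>) * indicator (\<Union>i. B i) (X \<omega>) \<partial>M) =
      (\<integral>\<^sup>+\<omega>. (\<Sum>i. indicator D (H \<omega>) * indicator (B i) (X \<omega>)) \<partial>M)"
      by (intro nn_integral_cong) (simp add: suminf_indicator[OF union(1)])
    also have "\<dots> = (\<Sum>i. \<integral>\<^sup>+\<omega>. indicator D (H \<omega>) * indicator (B i) (X \<omega>) \<partial>M)"
      by (rule nn_integral_suminf) measurable
    also have "\<dots> = (\<Sum>i. \<integral>\<^sup>+\<omega>. indicator D (H \<omega>) * emeasure (\<kappa> (H \<omega>)) (B i) \<partial>M)"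
      using union by simp
    also have "\<dots> = (\<integral>\<^sup>+\<omega>. (\<Sum>i. indicator D (H \<omega>) * emeasure (\<kappa> (H \<omega>)) (B i)) \<partial>M)"
      by (rule nn_integral_suminf[symmetric]) measurable
    also have "\<dots> = (\<integral>\<^sup>+\<omega>. indicator D (H \<omega>) * emeasure (\<kappa> (H \<omega>)) (\<Union>i. B i) \<partial>M)"
      using union(1) P(3)
      by (intro nn_integral_cong) (auto intro!: arg_cong2[where f="(*)"] suminf_emeasure)
    finally show ?case .
  qed
qed

text \<open>Both sides integrate \<open>g\<close> against a candidate for the joint law of
  \<open>(H, X)\<close>. The candidates agree on rectangles, hence everywhere.\<close>

lemma regular_cond_law_disintegration:
  assumes rcl: "regular_cond_law M N H S X \<kappa>"
    and g: "g \<in> borel_measurable (N \<Otimes>\<^sub>M S)"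
  shows "(\<integral>\<^sup>+\<omega>. g (H \<omega>, X \<omega>) \<partial>M) = (\<integral>\<^sup>+\<omega>. \<integral>\<^sup>+y. g (H \<omega>, y) \<partial>\<kappa> (H \<omega>) \<partial>M)"
proof -
  note rcl' = regular_cond_lawD[OF rcl]
  note [measurable] = rcl'(1-3) g
  \<comment> \<open>\<open>L h\<close> is the point mass at \<open>h\<close> times
    \<open>\<kappa> h\<close>; averaging it over the law of \<open>H\<close> gives the candidate
    joint law.\<close>
  define L where "L h = distr (\<kappa> h) (N \<Otimes>\<^sub>M S) (Pair h)" for h
  have L[measurable]: "L \<in> N \<rightarrow>\<^sub>M prob_algebra (N \<Otimes>\<^sub>M S)"
    unfolding L_def[abs_def] by measurable
  have L': "L \<in> distr M N H \<rightarrow>\<^sub>M subprob_algebra (N \<Otimes>\<^sub>M S)"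
    using measurable_prob_algebraD[OF L] by simp
  have ne: "space (distr M N H) \<noteq> {}"
    using prob_space.not_empty[OF prob_space_distr[OF rcl'(1)]] .
  have em: "emeasure (distr M (N \<Otimes>\<^sub>M S) (\<lambda>\<omega>. (H \<omega>, X \<omega>))) (D \<times> B) =
      emeasure (distr M N H \<bind> L) (D \<times> B)" if [measurable]: "D \<in> sets N" "B \<in> sets S" for D B
  proof -
    have "emeasure (distr M (N \<Otimes>\<^sub>M S) (\<lambda>\<omega>. (H \<omega>, X \<omega>))) (D \<times> B) =
      (\<integral>\<^sup>+z. indicator (D \<times> B) z \<partial>distr M (N \<Otimes>\<^sub>M S) (\<lambda>\<omega>. (H \<omega>, X \<omega>)))"
      by simp
    also have "\<dots> = (\<integral>\<^sup>+\<omega>. indicator D (H \<omega>) * indicator B (X \<omega>) \<partial>M)"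
      by (subst nn_integral_distr) (auto intro!: nn_integral_cong split: split_indicator)
    also have "\<dots> = (\<integral>\<^sup>+\<omega>. indicator D (H \<omega>) * emeasure (\<kappa> (H \<omega>)) B \<partial>M)"
      by (rule regular_cond_law_rectangle[OF rcl that])
    also have "\<dots> = (\<integral>\<^sup>+\<omega>. emeasure (L (H \<omega>)) (D \<times> B) \<partial>M)"
    proof (rule nn_integral_cong)
      fix \<omega> assume "\<omega> \<in> space M"
      then have h: "H \<omega> \<in> space N" by (rule measurable_space[OF rcl'(1)])
      have s: "sets (\<kappa> (H \<omega>)) = sets S" "space (\<kappa> (H \<omega>)) = space S"
        using kernel_simps[OF rcl'(3) h] by auto
      have "Pair (H \<omega>) \<in> \<kappa> (H \<omega>) \<rightarrow>\<^sub>M N \<Otimes>\<^sub>M S"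
        using measurable_Pair1'[OF h, of S] measurable_cong_sets[OF s(1) refl] by blast
      then have "emeasure (L (H \<omega>)) (D \<times> B) = emeasure (\<kappa> (H \<omega>)) (Pair (H \<omega>) -` (D \<times> B) \<inter> space S)"
        unfolding L_def by (subst emeasure_distr) (auto simp: s)
      also have "Pair (H \<omega>) -` (D \<times> B) \<inter> space S = (if H \<omega> \<in> D then B else {})"
        using sets.sets_into_space[OF that(2)] by auto
      finally show "indicator D (H \<omega>) * emeasure (\<kappa> (H \<omega>)) B = emeasure (L (H \<omega>)) (D \<times> B)"
        by auto
    qed
    also have "\<dots> = (\<integral>\<^sup>+h. emeasure (L h) (D \<times> B) \<partial>distr M N H)"
      by (rule nn_integral_distr[symmetric]) measurable
    also have "\<dots> = emeasure (distr M N H \<bind> L) (D \<times> B)"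
      by (rule emeasure_bind[symmetric, OF ne L']) simp
    finally show ?thesis .
  qed
  have "distr M (N \<Otimes>\<^sub>M S) (\<lambda>\<omega>. (H \<omega>, X \<omega>)) = distr M N H \<bind> L"
  proof (rule measure_eqI_generator_eq[OF Int_stable_pair_measure_generator[of N S], where A="\<lambda>_. space N \<times> space S"])
    show "{a \<times> b |a b. a \<in> sets N \<and> b \<in> sets S} \<subseteq> Pow (space N \<times> space S)"
      by (rule pair_measure_closed)
    show "sets (distr M (N \<Otimes>\<^sub>M S) (\<lambda>\<omega>. (H \<omega>, X \<omega>))) =
        sigma_sets (space N \<times> space S) {a \<times> b |a b. a \<in> sets N \<and> b \<in> sets S}"
      by (simp add: sets_pair_measure)
    show "sets (distr M N H \<bind> L) =
        sigma_sets (space N \<times> space S) {a \<times> b |a b. a \<in> sets N \<and> b \<in> sets S}"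
      using sets_bind[OF sets_kernel[OF L'] ne] by (simp add: sets_pair_measure)
    interpret P: prob_space "distr M (N \<Otimes>\<^sub>M S) (\<lambda>\<omega>. (H \<omega>, X \<omega>))"
      by (rule prob_space_distr) measurable
    show "emeasure (distr M (N \<Otimes>\<^sub>M S) (\<lambda>\<omega>. (H \<omega>, X \<omega>))) (space N \<times> space S) \<noteq> \<infinity>" for i :: nat
      by simp
  qed (use em in auto)
  then have "(\<integral>\<^sup>+z. g z \<partial>distr M (N \<Otimes>\<^sub>M S) (\<lambda>\<omega>. (H \<omega>, X \<omega>))) = (\<integral>\<^sup>+z. g z \<partial>(distr M N H \<bind> L))"
    by simp
  also have "\<dots> = (\<integral>\<^sup>+h. \<integral>\<^sup>+z. g z \<partial>L h \<partial>distr M N H)"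
    by (rule nn_integral_bind[OF g L'])
  also have "\<dots> = (\<integral>\<^sup>+\<omega>. \<integral>\<^sup>+z. g z \<partial>L (H \<omega>) \<partial>M)"
    using measurable_prob_algebraD[OF L]
    by (intro nn_integral_distr) (auto intro!: measurable_compose[OF _ nn_integral_measurable_subprob_algebra])
  also have "\<dots> = (\<integral>\<^sup>+\<omega>. \<integral>\<^sup>+y. g (H \<omega>, y) \<partial>\<kappa> (H \<omega>) \<partial>M)"
  proof (rule nn_integral_cong)
    fix \<omega> assume "\<omega> \<in> space M"
    then have h: "H \<omega> \<in> space N" by (rule measurable_space[OF rcl'(1)])
    have s: "sets (\<kappa> (H \<omega>)) = sets S"
      using kernel_simps[OF rcl'(3) h] by auto
    have "Pair (H \<omega>) \<in> \<kappa> (H \<omega>) \<rightarrow>\<^sub>M N \<Otimes>\<^sub>M S"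
      using measurable_Pair1'[OF h, of S] measurable_cong_sets[OF s(1) refl] by blast
    then show "(\<integral>\<^sup>+z. g z \<partial>L (H \<omega>)) = (\<integral>\<^sup>+y. g (H \<omega>, y) \<partial>\<kappa> (H \<omega>))"
      unfolding L_def by (subst nn_integral_distr) auto
  qed
  finally show ?thesis
    by (subst (asm) nn_integral_distr) auto
qed

lemma regular_cond_law_compose:
  assumes rcl: "regular_cond_law M N H S X \<kappa>" and g: "g \<in> S \<rightarrow>\<^sub>M S'"
  shows "regular_cond_law M N H S' (\<lambda>\<omega>. g (X \<omega>)) (\<lambda>h. distr (\<kappa> h) S' g)"
proof (rule regular_cond_lawI)
  note rcl' = regular_cond_lawD[OF rcl]
  note [measurable] = rcl'(1-3) g
  show "H \<in> M \<rightarrow>\<^sub>M N" "(\<lambda>\<omega>. g (X \<omega>)) \<in> M \<rightarrow>\<^sub>M S'" "(\<lambda>h. distr (\<kappa> h) S' g) \<in> N \<rightarrow>\<^sub>M prob_algebra S'"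
    by measurable
  fix D B assume [measurable]: "D \<in> sets N" "B \<in> sets S'"
  have "(\<integral>\<^sup>+\<omega>. indicator D (H \<omega>) * indicator B (g (X \<omega>)) \<partial>M) =
      (\<integral>\<^sup>+\<omega>. indicator D (H \<omega>) * indicator (g -` B \<inter> space S) (X \<omega>) \<partial>M)"
    using measurable_space[OF rcl'(2)] by (intro nn_integral_cong) (auto split: split_indicator)
  also have "\<dots> = (\<integral>\<^sup>+\<omega>. indicator D (H \<omega>) * emeasure (\<kappa> (H \<omega>)) (g -` B \<inter> space S) \<partial>M)"
    by (rule regular_cond_law_rectangle[OF rcl]) measurable
  also have "\<dots> = (\<integral>\<^sup>+\<omega>. indicator D (H \<omega>) * emeasure (distr (\<kappa> (H \<omega>)) S' g) B \<partial>M)"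
  proof (rule nn_integral_cong)
    fix \<omega> assume "\<omega> \<in> space M"
    then have s: "sets (\<kappa> (H \<omega>)) = sets S" "space (\<kappa> (H \<omega>)) = space S"
      using kernel_simps[OF rcl'(3)] measurable_space[OF rcl'(1)] by auto
    have "g \<in> \<kappa> (H \<omega>) \<rightarrow>\<^sub>M S'"
      using g measurable_cong_sets[OF s(1) refl] by blast
    then show "indicator D (H \<omega>) * emeasure (\<kappa> (H \<omega>)) (g -` B \<inter> space S) =
        indicator D (H \<omega>) * emeasure (distr (\<kappa> (H \<omega>)) S' g) B"
      by (simp add: emeasure_distr s)
  qed
  finally show "(\<integral>\<^sup>+\<omega>. indicator D (H \<omega>) * indicator B (g (X \<omega>)) \<partial>M) =
      (\<integral>\<^sup>+\<omega>. indicator D (H \<omega>) * emeasure (distr (\<kappa> (H \<omega>)) S' g) B \<partial>M)" .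
qed

text \<open>\<open>cond_indep\<close> factorises exactly on the rectangles
  \<open>B \<times> C\<close>, an intersection-stable generator of the product, so the product
  kernel need only be checked there.\<close>

lemma regular_cond_law_pair:
  assumes X: "regular_cond_law M N H S X \<kappa>" and Y: "regular_cond_law M N H T Y \<mu>"
    and indep: "cond_indep M N H S X T Y"
  shows "regular_cond_law M N H (S \<Otimes>\<^sub>M T) (\<lambda>\<omega>. (X \<omega>, Y \<omega>)) (\<lambda>h. \<kappa> h \<Otimes>\<^sub>M \<mu> h)"
proof (rule regular_cond_lawI_generator[OF _ _ _ Int_stable_pair_measure_generator[of S T]])
  note X' = regular_cond_lawD[OF X] and Y' = regular_cond_lawD[OF Y]
  note [measurable] = X'(1-3) Y'(2,3)
  show "H \<in> M \<rightarrow>\<^sub>M N" "(\<lambda>\<omega>. (X \<omega>, Y \<omega>)) \<in> M \<rightarrow>\<^sub>M S \<Otimes>\<^sub>M T"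
    "(\<lambda>h. \<kappa> h \<Otimes>\<^sub>M \<mu> h) \<in> N \<rightarrow>\<^sub>M prob_algebra (S \<Otimes>\<^sub>M T)"
    by measurable
  show "{a \<times> b |a b. a \<in> sets S \<and> b \<in> sets T} \<subseteq> Pow (space (S \<Otimes>\<^sub>M T))"
    using pair_measure_closed by (simp add: space_pair_measure)
  show "sets (S \<Otimes>\<^sub>M T) = sigma_sets (space (S \<Otimes>\<^sub>M T)) {a \<times> b |a b. a \<in> sets S \<and> b \<in> sets T}"
    by (simp add: space_pair_measure sets_pair_measure)
  fix D E assume D: "D \<in> sets N" and "E \<in> {a \<times> b |a b. a \<in> sets S \<and> b \<in> sets T}"
  then obtain B C where B: "B \<in> sets S" and C: "C \<in> sets T" and E: "E = B \<times> C" by auto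
  note [measurable] = B C D
  let ?f = "\<lambda>\<omega>. indicator B (X \<omega>) * indicator C (Y \<omega>) :: real"
  have "AE \<omega> in M. cond_exp_given M N H ?f \<omega> =
      cond_exp_given M N H (\<lambda>\<omega>. indicator B (X \<omega>)) \<omega> * cond_exp_given M N H (\<lambda>\<omega>. indicator C (Y \<omega>)) \<omega>"
    using indep B C by (auto simp: cond_indep_def)
  then have *: "AE \<omega> in M. cond_exp_given M N H ?f \<omega> = measure (\<kappa> (H \<omega>)) B * measure (\<mu> (H \<omega>)) C"
    using X'(4)[OF B] Y'(4)[OF C] by eventually_elim simp
  have "(\<integral>\<^sup>+\<omega>. indicator D (H \<omega>) * indicator E (X \<omega>, Y \<omega>) \<partial>M) =
      (\<integral>\<^sup>+\<omega>. indicator D (H \<omega>) * ennreal (?f \<omega>) \<partial>M)"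
    by (intro nn_integral_cong) (auto simp: E split: split_indicator)
  also have "\<dots> = (\<integral>\<^sup>+\<omega>. indicator D (H \<omega>) * ennreal (measure (\<kappa> (H \<omega>)) B * measure (\<mu> (H \<omega>)) C) \<partial>M)"
    by (rule cond_exp_given_nn_integral[OF X'(1) D _ _ *]) (auto split: split_indicator)
  also have "\<dots> = (\<integral>\<^sup>+\<omega>. indicator D (H \<omega>) * emeasure (\<kappa> (H \<omega>) \<Otimes>\<^sub>M \<mu> (H \<omega>)) E \<partial>M)"
  proof (rule nn_integral_cong)
    fix \<omega> assume "\<omega> \<in> space M"
    then have h: "H \<omega> \<in> space N" by (rule measurable_space[OF X'(1)])
    interpret K: prob_space "\<kappa> (H \<omega>)" by (rule kernel_simps(1)[OF X'(3) h])
    interpret L: prob_space "\<mu> (H \<omega>)" by (rule kernel_simps(1)[OF Y'(3) h])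
    show "indicator D (H \<omega>) * ennreal (measure (\<kappa> (H \<omega>)) B * measure (\<mu> (H \<omega>)) C) =
      indicator D (H \<omega>) * emeasure (\<kappa> (H \<omega>) \<Otimes>\<^sub>M \<mu> (H \<omega>)) E"
      unfolding E using B C kernel_simps(2)[OF X'(3) h] kernel_simps(2)[OF Y'(3) h]
      by (subst L.emeasure_pair_measure_Times)
        (auto simp: K.emeasure_eq_measure L.emeasure_eq_measure ennreal_mult)
  qed
  finally show "(\<integral>\<^sup>+\<omega>. indicator D (H \<omega>) * indicator E (X \<omega>, Y \<omega>) \<partial>M) =
      (\<integral>\<^sup>+\<omega>. indicator D (H \<omega>) * emeasure (\<kappa> (H \<omega>) \<Otimes>\<^sub>M \<mu> (H \<omega>)) E \<partial>M)" .
qed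

end


section \<open>Mutual information with a finite variable\<close>

text \<open>The summand of Shannon entropy in nats. The convention 0 ln 0 = 0 holds because the
  factor \<open>x\<close> vanishes, whatever \<open>ln 0\<close> is.\<close>

definition entropy_term :: "real \<Rightarrow> real" where
  "entropy_term x = - (x * ln x)"

lemma measurable_entropy_term [measurable]: "entropy_term \<in> borel_measurable borel"
  unfolding entropy_term_def[abs_def] by measurable

lemma entropy_term_nonneg: "0 \<le> x \<Longrightarrow> x \<le> 1 \<Longrightarrow> 0 \<le> entropy_term x"
  by (cases "x = 0") (auto simp: entropy_term_def mult_nonneg_nonpos)

text \<open>From ln y \<le> y - 1 at y = 1 / x. The crude constant is enough: it makes all entropy
  terms integrable over probability spaces.\<close>

lemma entropy_term_le_1:
  assumes "0 \<le> x" "x \<le> 1"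
  shows "entropy_term x \<le> 1"
proof (cases "x = 0")
  case False
  then have x: "0 < x" using assms by simp
  have "- ln x = ln (1 / x)" using x by (simp add: ln_div)
  also have "\<dots> \<le> 1 / x - 1" using x by (intro ln_le_minus_one) simp
  finally have "x * (- ln x) \<le> x * (1 / x - 1)"
    using x by (intro mult_left_mono) auto
  then show ?thesis using x by (simp add: entropy_term_def right_diff_distrib)
qed (simp add: entropy_term_def)

text \<open>\<open>f k y\<close> plays the conditional probability of \<open>fst = k\<close> given
  \<open>snd = y\<close>, so the formula is I(X; Y) = H(X) - H(X | Y). Since \<open>f\<close> is at
  most 1, every integral that occurs is finite.\<close>

lemma mutual_information_finite_fst:
  fixes P :: "('k \<times> 'y) measure" and f :: "'k \<Rightarrow> 'y \<Rightarrow> real"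
  assumes P: "prob_space P" "sets P = sets (count_space C \<Otimes>\<^sub>M T)" and C: "finite C"
    and f_meas: "\<And>k. k \<in> C \<Longrightarrow> f k \<in> borel_measurable T"
    and f_bnd: "\<And>k y. 0 \<le> f k y" "\<And>k y. f k y \<le> 1"
    and density: "\<And>k B. k \<in> C \<Longrightarrow> B \<in> sets T \<Longrightarrow>
      emeasure P ({k} \<times> B) = (\<integral>\<^sup>+y. ennreal (f k y) * indicator B y \<partial>distr P T snd)"
  shows "prob_space.mutual_information P (exp 1) (count_space C) T fst snd =
      (\<Sum>k\<in>C. entropy_term (measure P ({k} \<times> space T))) -
      (\<Sum>k\<in>C. \<integral>y. entropy_term (f k y) \<partial>distr P T snd)"
    and "0 \<le> prob_space.mutual_information P (exp 1) (count_space C) T fst snd"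
proof -
  interpret P: prob_space P by fact
  interpret P: information_space P "exp 1"
    by unfold_locales simp
  \<comment> \<open>With the second marginal as reference measure, \<open>snd\<close> has density 1
    and \<open>f\<close> is the joint density.\<close>
  define \<mu> where "\<mu> = distr P T snd"
  have sets_\<mu>[measurable_cong]: "sets \<mu> = sets T" and space_\<mu>: "space \<mu> = space T"
    by (auto simp: \<mu>_def)
  note P(2)[measurable_cong]
  have space_P: "space P = C \<times> space T"
    using sets_eq_imp_space_eq[OF P(2)] by (simp add: space_pair_measure)
  interpret \<mu>: prob_space \<mu>
    unfolding \<mu>_def by (rule P.prob_space_distr) simp
  have sf: "sigma_finite_measure (count_space C)"
    by (rule sigma_finite_measure_count_space_finite[OF C])
  interpret CC: sigma_finite_measure "count_space C" by fact
  interpret CP: pair_sigma_finite "count_space C" \<mu> ..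
  define p where "p k = measure P ({k} \<times> space T)" for k
  have p_nn: "0 \<le> p k" for k by (simp add: p_def)
  define q where "q z = f (fst z) (snd z)" for z
  have f_meas'[measurable]: "\<And>k. k \<in> C \<Longrightarrow> f k \<in> borel_measurable \<mu>"
    using f_meas by simp
  have int_f: "integrable \<mu> (f k)" if "k \<in> C" for k
    by (rule \<mu>.integrable_const_bound[where B=1]) (use that f_bnd in auto)
  have q_meas: "q \<in> borel_measurable (count_space C \<Otimes>\<^sub>M \<mu>)"
    unfolding q_def using C f_meas'
    by (intro measurable_compose_countable'[where I=C and g=fst and f="\<lambda>k z. f k (snd z)"])
      (auto simp: countable_finite)
  have ep: "emeasure P ({k} \<times> B) = ennreal (\<integral>y. f k y * indicator B y \<partial>\<mu>)" if "k \<in> C" "B \<in> sets T" for k B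
    unfolding density[OF that]
    using that f_bnd int_f[OF that(1)]
    by (subst nn_integral_eq_integral[symmetric])
      (auto simp: \<mu>_def[symmetric] intro!: nn_integral_cong Bochner_Integration.integrable_bound[OF int_f[OF that(1)]] split: split_indicator)
  have p_int: "p k = (\<integral>y. f k y \<partial>\<mu>)" if "k \<in> C" for k
  proof -
    have "(\<integral>y. f k y * indicator (space T) y \<partial>\<mu>) = (\<integral>y. f k y \<partial>\<mu>)"
      by (rule Bochner_Integration.integral_cong) (auto simp: space_\<mu>)
    then show ?thesis
      using ep[OF that sets.top] f_bnd by (simp add: p_def measure_def integral_nonneg)
  qed
  have dX: "distributed P (count_space C) fst (\<lambda>k. ennreal (p k))"
    unfolding distributed_def
  proof (intro conjI)
    show "distr P (count_space C) fst = density (count_space C) (\<lambda>k. ennreal (p k))"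
    proof (rule measure_eqI_finite[of _ C])
      fix k assume k: "k \<in> C"
      have "fst -` {k} \<inter> space P = {k} \<times> space T" using k by (auto simp: space_P)
      then show "emeasure (distr P (count_space C) fst) {k} =
          emeasure (density (count_space C) (\<lambda>k. ennreal (p k))) {k}"
        using k C by (simp add: emeasure_distr emeasure_density p_def P.emeasure_eq_measure
            nn_integral_count_space_finite indicator_def if_distrib cong: if_cong)
    qed (use C in auto)
  qed auto
  have dY: "distributed P \<mu> snd (\<lambda>_. ennreal 1)"
  proof -
    have "distr P \<mu> snd = distr P T snd"
      by (rule distr_cong) (simp_all add: sets_\<mu>)
    then show ?thesis
      unfolding distributed_def by (simp add: density_1 \<mu>_def[symmetric])
  qed
  have dXY: "distributed P (count_space C \<Otimes>\<^sub>M \<mu>) (\<lambda>z. (fst z, snd z)) (\<lambda>z. ennreal (q z))"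
    unfolding distributed_def
  proof (intro conjI)
    show "distr P (count_space C \<Otimes>\<^sub>M \<mu>) (\<lambda>z. (fst z, snd z)) = density (count_space C \<Otimes>\<^sub>M \<mu>) (\<lambda>z. ennreal (q z))"
    proof (rule measure_eqI)
      fix E assume "E \<in> sets (distr P (count_space C \<Otimes>\<^sub>M \<mu>) (\<lambda>z. (fst z, snd z)))"
      then have E: "E \<in> sets (count_space C \<Otimes>\<^sub>M \<mu>)" by simp
      have E': "E \<in> sets P" using E P(2) sets_pair_measure_cong[OF refl sets_\<mu>, of "count_space C"] by simp
      define B where "B k = Pair k -` E" for k
      have B[measurable]: "B k \<in> sets T" for k
        using sets_Pair1[OF E, of k] by (simp add: B_def sets_\<mu>)
      have E_eq: "E = (\<Union>k\<in>C. {k} \<times> B k)"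
        using sets.sets_into_space[OF E] by (auto simp: B_def space_pair_measure)
      have "emeasure (density (count_space C \<Otimes>\<^sub>M \<mu>) (\<lambda>z. ennreal (q z))) E =
          (\<integral>\<^sup>+z. ennreal (q z) * indicator E z \<partial>(count_space C \<Otimes>\<^sub>M \<mu>))"
        using E q_meas by (simp add: emeasure_density)
      also have "\<dots> = (\<integral>\<^sup>+k. \<integral>\<^sup>+y. ennreal (q (k, y)) * indicator E (k, y) \<partial>\<mu> \<partial>count_space C)"
        using E q_meas by (subst \<mu>.nn_integral_fst) auto
      also have "\<dots> = (\<Sum>k\<in>C. \<integral>\<^sup>+y. ennreal (f k y) * indicator (B k) y \<partial>\<mu>)"
        using C by (simp add: nn_integral_count_space_finite q_def B_def indicator_def)
      also have "\<dots> = (\<Sum>k\<in>C. emeasure P ({k} \<times> B k))"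
        using density B by (simp add: \<mu>_def)
      also have "\<dots> = emeasure P E"
        unfolding E_eq using C
        by (intro sum_emeasure) (auto simp: P(2) disjoint_family_on_def)
      also have "\<dots> = emeasure (distr P (count_space C \<Otimes>\<^sub>M \<mu>) (\<lambda>z. (fst z, snd z))) E"
        using E sets.sets_into_space[OF E']
        by (subst emeasure_distr) (auto intro!: arg_cong[where f="emeasure P"])
      finally show "emeasure (distr P (count_space C \<Otimes>\<^sub>M \<mu>) (\<lambda>z. (fst z, snd z))) E =
          emeasure (density (count_space C \<Otimes>\<^sub>M \<mu>) (\<lambda>z. ennreal (q z))) E" by simp
    qed simp
  qed (use q_meas in auto)
  define F where "F z = q z * log (exp 1) (q z / (p (fst z) * 1))" for z
  \<comment> \<open>Mutual information uses its target space only through image measures, hence only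
    through the algebra of events, so \<open>T\<close> may be exchanged for
    \<open>\<mu>\<close>.\<close>
  have mi_eq: "P.mutual_information (exp 1) (count_space C) T fst snd =
      P.mutual_information (exp 1) (count_space C) \<mu> fst snd"
    unfolding P.mutual_information_def
    by (intro arg_cong2[where f="KL_divergence (exp 1)"] arg_cong2[where f="(\<Otimes>\<^sub>M)"] distr_cong
        refl sets_pair_measure_cong) (simp_all add: sets_\<mu>)
  note mi = P.mutual_information_distr[OF sf \<mu>.sigma_finite_measure dX p_nn dY _ dXY]
    P.mutual_information_nonneg[OF sf \<mu>.sigma_finite_measure dX p_nn dY _ dXY]
  have F_k: "integrable \<mu> (\<lambda>y. F (k, y))"
    "(\<integral>y. F (k, y) \<partial>\<mu>) = entropy_term (p k) - (\<integral>y. entropy_term (f k y) \<partial>\<mu>)" if k: "k \<in> C" for k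
  proof -
    have ie: "integrable \<mu> (\<lambda>y. entropy_term (f k y))"
      by (rule \<mu>.integrable_const_bound[where B=1])
        (use k f_bnd entropy_term_nonneg entropy_term_le_1 in auto)
    have ae: "AE y in \<mu>. F (k, y) = - entropy_term (f k y) - f k y * ln (p k)"
    \<comment> \<open>If \<open>p k = 0\<close>, the nonnegative \<open>f k\<close> has integral 0
      and vanishes almost everywhere, so the quotient by \<open>p k\<close> does no harm.\<close>
    proof (cases "p k = 0")
      case True
      then have "AE y in \<mu>. f k y = 0"
        using p_int[OF k] integral_nonneg_eq_0_iff_AE[OF int_f[OF k]] f_bnd by auto
      then show ?thesis
        by eventually_elim (simp add: F_def q_def entropy_term_def)
    next
      case False
      then have "0 < p k" using p_nn[of k] by simp
      then have "F (k, y) = - entropy_term (f k y) - f k y * ln (p k)" for y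
        using f_bnd(1)[of k y]
        by (cases "f k y = 0") (auto simp: F_def q_def entropy_term_def log_def ln_div algebra_simps)
      then show ?thesis by simp
    qed
    have i: "integrable \<mu> (\<lambda>y. - entropy_term (f k y) - f k y * ln (p k))"
      using ie int_f[OF k] by auto
    have Fm: "(\<lambda>y. F (k, y)) \<in> borel_measurable \<mu>"
      unfolding F_def q_def using k by simp
    show "integrable \<mu> (\<lambda>y. F (k, y))"
      by (rule integrable_cong_AE_imp[OF i Fm]) (use ae in \<open>auto elim: eventually_mono\<close>)
    have "(\<integral>y. F (k, y) \<partial>\<mu>) = (\<integral>y. - entropy_term (f k y) - f k y * ln (p k) \<partial>\<mu>)"
      by (rule integral_cong_AE) (use Fm i ae in auto)
    also have "\<dots> = entropy_term (p k) - (\<integral>y. entropy_term (f k y) \<partial>\<mu>)"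
      using ie int_f[OF k] by (simp add: p_int[OF k] entropy_term_def)
    finally show "(\<integral>y. F (k, y) \<partial>\<mu>) = entropy_term (p k) - (\<integral>y. entropy_term (f k y) \<partial>\<mu>)" .
  qed
  have F_meas: "F \<in> borel_measurable (count_space C \<Otimes>\<^sub>M \<mu>)"
  proof -
    have "(\<lambda>z. p (fst z)) \<in> borel_measurable (count_space C \<Otimes>\<^sub>M \<mu>)"
      by (rule measurable_compose[OF measurable_fst]) simp
    then show ?thesis
      unfolding F_def[abs_def] using q_meas by (auto simp: log_def)
  qed
  have F_int: "integrable (count_space C \<Otimes>\<^sub>M \<mu>) F"
    using C F_k F_meas
    by (intro CP.Fubini_integrable) (auto simp: integrable_count_space)
  have "P.mutual_information (exp 1) (count_space C) T fst snd = (\<integral>z. F z \<partial>(count_space C \<Otimes>\<^sub>M \<mu>))"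
    unfolding mi_eq F_def[abs_def] by (rule mi(1)) (auto simp: f_bnd q_def)
  also have "\<dots> = (\<integral>k. \<integral>y. F (k, y) \<partial>\<mu> \<partial>count_space C)"
    by (rule CP.integral_fst'[OF F_int, symmetric])
  also have "\<dots> = (\<Sum>k\<in>C. entropy_term (p k)) - (\<Sum>k\<in>C. \<integral>y. entropy_term (f k y) \<partial>\<mu>)"
    using C F_k by (simp add: lebesgue_integral_count_space_finite sum_subtractf)
  finally show "P.mutual_information (exp 1) (count_space C) T fst snd =
      (\<Sum>k\<in>C. entropy_term (measure P ({k} \<times> space T))) -
      (\<Sum>k\<in>C. \<integral>y. entropy_term (f k y) \<partial>distr P T snd)"
    by (simp add: p_def \<mu>_def)
  show "0 \<le> P.mutual_information (exp 1) (count_space C) T fst snd"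
    unfolding mi_eq using F_int[unfolded F_def[abs_def]] by (intro mi(2)) (auto simp: f_bnd q_def)
qed


section \<open>The chain rule\<close>

text \<open>A countable family has only countably many finite intersections. Closure under
  intersection and membership of \<open>\<Omega>\<close> are what uniqueness of finite measures
  requires of a generator.\<close>

lemma countably_generated_Int_stable:
  assumes G: "countable G" "G \<subseteq> Pow \<Omega>"
  obtains G' where "countable G'" "G' \<subseteq> Pow \<Omega>" "Int_stable G'" "\<Omega> \<in> G'"
    "sigma_sets \<Omega> G' = sigma_sets \<Omega> G"
proof
  \<comment> \<open>Intersecting with \<open>\<Omega>\<close> makes the empty \<open>F\<close>
    contribute \<open>\<Omega>\<close> itself, since \<open>\<Inter>{}\<close> is
    \<open>UNIV\<close>.\<close>
  define G' where "G' = (\<lambda>F. \<Omega> \<inter> \<Inter>F) ` {F. finite F \<and> F \<subseteq> G}"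
  show "countable G'"
    unfolding G'_def using G(1) by (intro countable_image countable_Collect_finite_subset)
  show "G' \<subseteq> Pow \<Omega>" by (auto simp: G'_def)
  show "Int_stable G'"
  proof (rule Int_stableI)
    fix a b assume "a \<in> G'" "b \<in> G'"
    then obtain F1 F2 where F: "finite F1" "F1 \<subseteq> G" "finite F2" "F2 \<subseteq> G"
      and ab: "a = \<Omega> \<inter> \<Inter>F1" "b = \<Omega> \<inter> \<Inter>F2" by (auto simp: G'_def)
    have "a \<inter> b = \<Omega> \<inter> \<Inter>(F1 \<union> F2)" by (auto simp: ab)
    then show "a \<inter> b \<in> G'" using F unfolding G'_def by blast
  qed
  show "\<Omega> \<in> G'" unfolding G'_def by (rule image_eqI[where x="{}"]) auto
  interpret sigma_algebra \<Omega> "sigma_sets \<Omega> G" by (rule sigma_algebra_sigma_sets[OF G(2)])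
  show "sigma_sets \<Omega> G' = sigma_sets \<Omega> G"
  proof (rule sigma_sets_eqI)
    fix a assume "a \<in> G'"
    then obtain F where F: "finite F" "F \<subseteq> G" "a = \<Omega> \<inter> \<Inter>F" by (auto simp: G'_def)
    show "a \<in> sigma_sets \<Omega> G"
    proof (cases "F = {}")
      case False
      then have "\<Inter>F \<in> sigma_sets \<Omega> G"
        using finite_INT[OF F(1) False, of "\<lambda>x. x"] F(2) by auto
      then show ?thesis unfolding F(3) by auto
    qed (simp add: F)
  next
    fix b assume b: "b \<in> G"
    then have "b = \<Omega> \<inter> \<Inter>{b}" using G(2) by auto
    then have "b \<in> G'" unfolding G'_def using b by blast
    then show "b \<in> sigma_sets \<Omega> G'" by auto
  qed
qed

text \<open>The conditional entropy H(Z | H), averaged over \<open>H\<close>. Conditional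
  probabilities are used in place of a conditional law so that the value depends on \<open>H\<close>
  only through the algebra that it generates.\<close>

definition entropy_given ::
  "'w measure \<Rightarrow> 'h measure \<Rightarrow> ('w \<Rightarrow> 'h) \<Rightarrow> 'k set \<Rightarrow> ('w \<Rightarrow> 'k) \<Rightarrow> real" where
  "entropy_given M N H C Z =
     (\<integral>\<omega>. (\<Sum>k\<in>C. entropy_term (cond_exp_given M N H (\<lambda>\<omega>. indicator {k} (Z \<omega>)) \<omega>)) \<partial>M)"

context prob_space
begin

lemma entropy_given_terms:
  assumes H: "H \<in> M \<rightarrow>\<^sub>M N" and Z: "Z \<in> M \<rightarrow>\<^sub>M count_space C"
  shows "integrable M (\<lambda>\<omega>. entropy_term (cond_exp_given M N H (\<lambda>\<omega>. indicator {k} (Z \<omega>)) \<omega>))"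
    and "AE \<omega> in M. 0 \<le> entropy_term (cond_exp_given M N H (\<lambda>\<omega>. indicator {k} (Z \<omega>)) \<omega>)"
proof -
  have "(\<lambda>\<omega>. indicator {k} (Z \<omega>) :: real) \<in> borel_measurable M"
    using Z by (intro measurable_compose[OF Z]) simp
  from cond_exp_given_bounds[OF H this]
  have *: "AE \<omega> in M. 0 \<le> cond_exp_given M N H (\<lambda>\<omega>. indicator {k} (Z \<omega>)) \<omega> \<and>
    cond_exp_given M N H (\<lambda>\<omega>. indicator {k} (Z \<omega>)) \<omega> \<le> 1"
    by (auto split: split_indicator)
  show "AE \<omega> in M. 0 \<le> entropy_term (cond_exp_given M N H (\<lambda>\<omega>. indicator {k} (Z \<omega>)) \<omega>)"
    using * by eventually_elim (auto intro: entropy_term_nonneg)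
  show "integrable M (\<lambda>\<omega>. entropy_term (cond_exp_given M N H (\<lambda>\<omega>. indicator {k} (Z \<omega>)) \<omega>))"
  proof (rule integrable_const_bound[where B=1])
    show "AE \<omega> in M. norm (entropy_term (cond_exp_given M N H (\<lambda>\<omega>. indicator {k} (Z \<omega>)) \<omega>)) \<le> 1"
      using * by eventually_elim (simp add: entropy_term_nonneg entropy_term_le_1)
  qed measurable
qed

lemma entropy_given_nonneg:
  assumes H: "H \<in> M \<rightarrow>\<^sub>M N" and Z: "Z \<in> M \<rightarrow>\<^sub>M count_space C"
  shows "0 \<le> entropy_given M N H C Z"
proof (cases "finite C")
  case True
  then show ?thesis
    unfolding entropy_given_def
    by (subst Bochner_Integration.integral_sum)
      (auto intro!: sum_nonneg integral_nonneg_AE entropy_given_terms[OF H Z])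
qed (simp add: entropy_given_def)

text \<open>Writing \<open>P(Z = k | H, Y) = f k (H, Y)\<close>, the conditional law of \<open>(Z, Y)\<close> given \<open>H = h\<close> has the
  density \<open>f k (h, y)\<close> on \<open>{k}\<close> with respect to that of \<open>Y\<close>; a countable generator of \<open>T\<close> makes the
  exceptional set of \<open>h\<close> independent of the event.\<close>

lemma mutual_information_chain_rule:
  fixes H :: "'a \<Rightarrow> 'h" and Y :: "'a \<Rightarrow> 'y" and Z :: "'a \<Rightarrow> 'k"
  assumes rcl: "regular_cond_law M N H (count_space C \<Otimes>\<^sub>M T) (\<lambda>\<omega>. (Z \<omega>, Y \<omega>)) \<kappa>"
    and C: "finite C"
    and G: "countable G" "G \<subseteq> Pow (space T)" "sets T = sigma_sets (space T) G"
  obtains J where "integrable M J"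
    "AE \<omega> in M. prob_space.mutual_information (\<kappa> (H \<omega>)) (exp 1) (count_space C) T fst snd = J \<omega> \<and> 0 \<le> J \<omega>"
    "(\<integral>\<omega>. J \<omega> \<partial>M) = entropy_given M N H C Z - entropy_given M (N \<Otimes>\<^sub>M T) (\<lambda>\<omega>. (H \<omega>, Y \<omega>)) C Z"
proof -
  obtain G' where G': "countable G'" "G' \<subseteq> Pow (space T)" "Int_stable G'" "space T \<in> G'"
    "sets T = sigma_sets (space T) G'"
    using countably_generated_Int_stable[OF G(1,2)] G(3) by metis
  note rcl' = regular_cond_lawD[OF rcl]
  have H[measurable]: "H \<in> M \<rightarrow>\<^sub>M N" by (rule rcl')
  have Z[measurable]: "Z \<in> M \<rightarrow>\<^sub>M count_space C"
    using measurable_compose[OF rcl'(2) measurable_fst] by simp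
  have Y[measurable]: "Y \<in> M \<rightarrow>\<^sub>M T"
    using measurable_compose[OF rcl'(2) measurable_snd] by simp
  have \<kappa>[measurable]: "\<kappa> \<in> N \<rightarrow>\<^sub>M prob_algebra (count_space C \<Otimes>\<^sub>M T)" by (rule rcl')
  have ind_meas[measurable]: "(\<lambda>\<omega>. indicator {k} (Z \<omega>) :: real) \<in> borel_measurable M" for k
    by (rule measurable_compose[OF Z]) simp
  have HY: "(\<lambda>\<omega>. (H \<omega>, Y \<omega>)) \<in> M \<rightarrow>\<^sub>M N \<Otimes>\<^sub>M T" by measurable
  define c where "c k = cond_exp_given M N H (\<lambda>\<omega>. indicator {k} (Z \<omega>))" for k
  define c' where "c' k = cond_exp_given M (N \<Otimes>\<^sub>M T) (\<lambda>\<omega>. (H \<omega>, Y \<omega>)) (\<lambda>\<omega>. indicator {k} (Z \<omega>))" for k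
  define \<mu> where "\<mu> h = distr (\<kappa> h) T snd" for h
  have \<mu>_rcl: "regular_cond_law M N H T Y \<mu>"
    using regular_cond_law_compose[OF rcl measurable_snd] unfolding \<mu>_def[abs_def] by simp
  have \<mu>[measurable]: "\<mu> \<in> N \<rightarrow>\<^sub>M prob_algebra T" by (rule regular_cond_lawD(3)[OF \<mu>_rcl])
  have "\<exists>f. f \<in> borel_measurable (N \<Otimes>\<^sub>M T) \<and> (\<forall>x. 0 \<le> f x \<and> f x \<le> 1) \<and>
      (AE \<omega> in M. c' k \<omega> = f (H \<omega>, Y \<omega>))" for k
  proof -
    obtain g where "g \<in> borel_measurable (N \<Otimes>\<^sub>M T)" "\<And>x. 0 \<le> g x" "\<And>x. g x \<le> 1"
      "AE \<omega> in M. cond_exp_given M (N \<Otimes>\<^sub>M T) (\<lambda>\<omega>. (H \<omega>, Y \<omega>)) (\<lambda>\<omega>. indicator {k} (Z \<omega>)) \<omega> = g (H \<omega>, Y \<omega>)"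
      by (rule cond_exp_given_factorises[OF HY ind_meas[of k]]) (auto split: split_indicator)
    then show ?thesis unfolding c'_def by blast
  qed
  then obtain f :: "'k \<Rightarrow> 'h \<times> 'y \<Rightarrow> real" where f[measurable]: "\<And>k. f k \<in> borel_measurable (N \<Otimes>\<^sub>M T)"
    and f_bnd: "\<And>k x. 0 \<le> f k x" "\<And>k x. f k x \<le> 1"
    and f_eq: "\<And>k. AE \<omega> in M. c' k \<omega> = f k (H \<omega>, Y \<omega>)"
    by metis
  have kB[measurable]: "{k} \<times> B \<in> sets (count_space C \<Otimes>\<^sub>M T)" if "k \<in> C" "B \<in> sets T" for k B
    using that by auto
  define v where "v k B h = (\<integral>\<^sup>+y. ennreal (f k (h, y)) * indicator B y \<partial>\<mu> h)" for k B h
  have v_meas[measurable]: "v k B \<in> borel_measurable N" if [measurable]: "B \<in> sets T" for k B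
    unfolding v_def[abs_def]
    by (rule nn_integral_measurable_subprob_algebra2[OF _ measurable_prob_algebraD[OF \<mu>]]) measurable
  \<comment> \<open>Integrated over an event \<open>D\<close> of \<open>H\<close>, both sides give
    the probability of \<open>H \<in> D\<close>, \<open>Z = k\<close>, \<open>Y \<in> B\<close>: the
    left by the kernel, the right by the choice of \<open>f\<close> and disintegration over the law
    of \<open>Y\<close>.\<close>
  have dens1: "AE \<omega> in M. emeasure (\<kappa> (H \<omega>)) ({k} \<times> B) = v k B (H \<omega>)"
    if k: "k \<in> C" and B[measurable]: "B \<in> sets T" for k B
  proof (rule AE_eq_compose[OF H])
    show "(\<lambda>h. emeasure (\<kappa> h) ({k} \<times> B)) \<in> borel_measurable N"
      using k B by measurable
    fix D assume D[measurable]: "D \<in> sets N"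
    have "(\<integral>\<^sup>+\<omega>. indicator D (H \<omega>) * emeasure (\<kappa> (H \<omega>)) ({k} \<times> B) \<partial>M) =
        (\<integral>\<^sup>+\<omega>. indicator D (H \<omega>) * indicator ({k} \<times> B) (Z \<omega>, Y \<omega>) \<partial>M)"
      by (rule regular_cond_law_rectangle[OF rcl D kB[OF k B], symmetric])
    also have "\<dots> = (\<integral>\<^sup>+\<omega>. indicator (D \<times> B) (H \<omega>, Y \<omega>) * ennreal (indicator {k} (Z \<omega>)) \<partial>M)"
      by (intro nn_integral_cong) (auto split: split_indicator)
    also have "\<dots> = (\<integral>\<^sup>+\<omega>. indicator (D \<times> B) (H \<omega>, Y \<omega>) * ennreal (f k (H \<omega>, Y \<omega>)) \<partial>M)"
      by (rule cond_exp_given_nn_integral[OF HY _ ind_meas _ f_eq[unfolded c'_def]])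
        (auto split: split_indicator)
    also have "\<dots> = (\<integral>\<^sup>+\<omega>. \<integral>\<^sup>+y. indicator (D \<times> B) (H \<omega>, y) * ennreal (f k (H \<omega>, y)) \<partial>\<mu> (H \<omega>) \<partial>M)"
      by (rule regular_cond_law_disintegration[OF \<mu>_rcl]) measurable
    also have "\<dots> = (\<integral>\<^sup>+\<omega>. indicator D (H \<omega>) * v k B (H \<omega>) \<partial>M)"
      by (intro nn_integral_cong) (auto simp: v_def mult.commute split: split_indicator intro!: nn_integral_cong)
    finally show "(\<integral>\<^sup>+\<omega>. indicator D (H \<omega>) * emeasure (\<kappa> (H \<omega>)) ({k} \<times> B) \<partial>M) =
      (\<integral>\<^sup>+\<omega>. indicator D (H \<omega>) * v k B (H \<omega>) \<partial>M)" .
  qed (rule v_meas[OF B])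
  have "AE \<omega> in M. \<forall>k\<in>C. \<forall>B\<in>G'. emeasure (\<kappa> (H \<omega>)) ({k} \<times> B) = v k B (H \<omega>)"
    using dens1 G'(1,5) C by (simp add: AE_ball_countable countable_finite)
  then have dens: "AE \<omega> in M. \<forall>k\<in>C. \<forall>B\<in>sets T. emeasure (\<kappa> (H \<omega>)) ({k} \<times> B) = v k B (H \<omega>)"
    using AE_space
  proof eventually_elim
    case (elim \<omega>)
    define h where "h = H \<omega>"
    have h: "h \<in> space N" using measurable_space[OF H] elim(2) by (simp add: h_def)
    interpret K: prob_space "\<kappa> h" by (rule kernel_simps(1)[OF \<kappa> h])
    have sK[measurable_cong]: "sets (\<kappa> h) = sets (count_space C \<Otimes>\<^sub>M T)" by (rule kernel_simps(2)[OF \<kappa> h])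
    have sm[measurable_cong]: "sets (\<mu> h) = sets T" by (rule kernel_simps(2)[OF \<mu> h])
    show ?case unfolding h_def[symmetric]
    proof (intro ballI)
      fix k B assume k: "k \<in> C" and B: "B \<in> sets T"
      have fk[measurable]: "(\<lambda>y. f k (h, y)) \<in> borel_measurable T"
        using h by measurable
      \<comment> \<open>The part of \<open>\<kappa> h\<close> on the slice over \<open>k\<close>,
        read as a measure on \<open>T\<close>. For fixed \<open>h\<close> and \<open>k\<close> the
        claim becomes equality of two measures on \<open>T\<close>.\<close>
      define m1 where "m1 = distr (restrict_space (\<kappa> h) ({k} \<times> space T)) T snd"
      have kT: "{k} \<times> space T \<in> sets (\<kappa> h)" using k by (simp add: sK)
      have m1: "emeasure m1 E = emeasure (\<kappa> h) ({k} \<times> E)" if E: "E \<in> sets T" for E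
      proof -
        have "snd \<in> restrict_space (\<kappa> h) ({k} \<times> space T) \<rightarrow>\<^sub>M T"
          by (rule measurable_restrict_space1) measurable
        then have "emeasure m1 E = emeasure (restrict_space (\<kappa> h) ({k} \<times> space T))
            (snd -` E \<inter> space (restrict_space (\<kappa> h) ({k} \<times> space T)))"
          unfolding m1_def using E by (simp add: emeasure_distr)
        also have "snd -` E \<inter> space (restrict_space (\<kappa> h) ({k} \<times> space T)) = {k} \<times> E"
          using sets.sets_into_space[OF E] k sets_eq_imp_space_eq[OF sK]
          by (auto simp: space_restrict_space space_pair_measure)
        also have "emeasure (restrict_space (\<kappa> h) ({k} \<times> space T)) ({k} \<times> E) = emeasure (\<kappa> h) ({k} \<times> E)"
          using kT sets.sets_into_space[OF E] by (intro emeasure_restrict_space) auto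
        finally show ?thesis .
      qed
      define m2 where "m2 = density (\<mu> h) (\<lambda>y. ennreal (f k (h, y)))"
      have m2: "emeasure m2 E = v k E h" if E: "E \<in> sets T" for E
        using E by (simp add: m2_def emeasure_density sm v_def)
      have "m1 = m2"
      \<comment> \<open>\<open>space T\<close> belongs to \<open>G'\<close>, so it can serve as the
        constant exhausting sequence; its mass is finite.\<close>
      proof (rule measure_eqI_generator_eq[OF G'(3,2), where A="\<lambda>_. space T"])
        fix E assume "E \<in> G'"
        then show "emeasure m1 E = emeasure m2 E"
          using elim(1) k G'(5) by (simp add: m1 m2 h_def)
      qed (use G'(4,5) kB k in \<open>auto simp: m1_def[THEN arg_cong[where f=sets]] m2_def[THEN arg_cong[where f=sets]] sm m1\<close>)
      then show "emeasure (\<kappa> h) ({k} \<times> B) = v k B h"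
        using m1[OF B] m2[OF B] by simp
    qed
  qed
  define p where "p k h = measure (\<kappa> h) ({k} \<times> space T)" for k h
  have p_eq: "AE \<omega> in M. c k \<omega> = p k (H \<omega>)" if k: "k \<in> C" for k
  proof -
    have "AE \<omega> in M. cond_exp_given M N H (\<lambda>\<omega>. indicator ({k} \<times> space T) (Z \<omega>, Y \<omega>)) \<omega> = p k (H \<omega>)"
      unfolding p_def by (rule rcl'(4)) (rule kB[OF k sets.top])
    moreover have "AE \<omega> in M. cond_exp_given M N H (\<lambda>\<omega>. indicator ({k} \<times> space T) (Z \<omega>, Y \<omega>)) \<omega> = c k \<omega>"
      unfolding c_def cond_exp_given_def
      using measurable_space[OF Y] k
      by (intro sigma_finite_subalgebra.real_cond_exp_cong[OF sigma_finite_subalgebra_vimage[OF H]] AE_I2)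
        (auto split: split_indicator)
    ultimately show ?thesis by eventually_elim simp
  qed
  \<comment> \<open>Going through a nonnegative integral gives measurability in \<open>h\<close>
    from the kernel \<open>\<mu>\<close>; \<open>e_int\<close> identifies the value with the Bochner
    integral.\<close>
  define e where "e k h = enn2real (\<integral>\<^sup>+y. ennreal (entropy_term (f k (h, y))) \<partial>\<mu> h)" for k h
  have et_bnd: "0 \<le> entropy_term (f k x)" "entropy_term (f k x) \<le> 1" for k x
    using f_bnd by (intro entropy_term_nonneg entropy_term_le_1; blast)+
  have e_int: "e k h = (\<integral>y. entropy_term (f k (h, y)) \<partial>\<mu> h)"
    and e_nn: "ennreal (e k h) = (\<integral>\<^sup>+y. ennreal (entropy_term (f k (h, y))) \<partial>\<mu> h)"
    and e_bnd: "0 \<le> e k h" "e k h \<le> 1" if h: "h \<in> space N" for k h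
  proof -
    interpret m: prob_space "\<mu> h" by (rule kernel_simps(1)[OF \<mu> h])
    have sm[measurable_cong]: "sets (\<mu> h) = sets T" by (rule kernel_simps(2)[OF \<mu> h])
    have [measurable]: "(\<lambda>y. f k (h, y)) \<in> borel_measurable (\<mu> h)"
      using h by measurable
    show "e k h = (\<integral>y. entropy_term (f k (h, y)) \<partial>\<mu> h)"
      unfolding e_def by (rule integral_eq_nn_integral[symmetric]) (auto simp: et_bnd)
    have le: "(\<integral>\<^sup>+y. ennreal (entropy_term (f k (h, y))) \<partial>\<mu> h) \<le> 1"
    proof -
      have "(\<integral>\<^sup>+y. ennreal (entropy_term (f k (h, y))) \<partial>\<mu> h) \<le> (\<integral>\<^sup>+y. 1 \<partial>\<mu> h)"
        by (intro nn_integral_mono) (simp add: et_bnd)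
      then show ?thesis by (simp add: m.emeasure_space_1)
    qed
    then show nn: "ennreal (e k h) = (\<integral>\<^sup>+y. ennreal (entropy_term (f k (h, y))) \<partial>\<mu> h)"
      unfolding e_def using le_less_trans[OF le, of top] by (intro ennreal_enn2real) simp
    show "0 \<le> e k h" by (simp add: e_def)
    show "e k h \<le> 1" using le unfolding nn[symmetric] by simp
  qed
  have [measurable]: "e k \<in> borel_measurable N" for k
    unfolding e_def[abs_def]
    by (intro measurable_compose[OF nn_integral_measurable_subprob_algebra2[OF _ measurable_prob_algebraD[OF \<mu>]]
        borel_measurable_enn2real]) measurable
  have HN: "H \<omega> \<in> space N" if "\<omega> \<in> space M" for \<omega>
    using measurable_space[OF H that] .
  have eH_int: "integrable M (\<lambda>\<omega>. e k (H \<omega>))" for k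
    by (rule integrable_const_bound[where B=1]) (use e_bnd HN in auto)
  \<comment> \<open>Averaging the inner integral over \<open>H\<close> undoes the disintegration of
    \<open>(H, Y)\<close>, and \<open>f k (H, Y)\<close> is \<open>c' k\<close> almost
    everywhere.\<close>
  have c'_int: "(\<integral>\<omega>. e k (H \<omega>) \<partial>M) = (\<integral>\<omega>. entropy_term (c' k \<omega>) \<partial>M)" for k
  proof -
    have "(\<integral>\<omega>. e k (H \<omega>) \<partial>M) = enn2real (\<integral>\<^sup>+\<omega>. ennreal (e k (H \<omega>)) \<partial>M)"
      by (rule integral_eq_nn_integral) (use e_bnd HN in auto)
    also have "(\<integral>\<^sup>+\<omega>. ennreal (e k (H \<omega>)) \<partial>M) =
        (\<integral>\<^sup>+\<omega>. \<integral>\<^sup>+y. ennreal (entropy_term (f k (H \<omega>, y))) \<partial>\<mu> (H \<omega>) \<partial>M)"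
      by (intro nn_integral_cong e_nn HN)
    also have "\<dots> = (\<integral>\<^sup>+\<omega>. ennreal (entropy_term (f k (H \<omega>, Y \<omega>))) \<partial>M)"
      by (rule regular_cond_law_disintegration[OF \<mu>_rcl, symmetric]) measurable
    also have "enn2real \<dots> = (\<integral>\<omega>. entropy_term (f k (H \<omega>, Y \<omega>)) \<partial>M)"
      by (rule integral_eq_nn_integral[symmetric]) (auto simp: et_bnd)
    also have "\<dots> = (\<integral>\<omega>. entropy_term (c' k \<omega>) \<partial>M)"
      by (rule integral_cong_AE) (use f_eq[of k] in \<open>auto simp: c'_def elim!: eventually_mono\<close>)
    finally show ?thesis .
  qed
  \<comment> \<open>Integrable by construction, being built from conditional probabilities and
    \<open>e\<close>; the mutual information is compared with it only almost everywhere.\<close>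
  define J where "J \<omega> = (\<Sum>k\<in>C. entropy_term (c k \<omega>)) - (\<Sum>k\<in>C. e k (H \<omega>))" for \<omega>
  note terms = entropy_given_terms[OF H Z, folded c_def] and terms' = entropy_given_terms[OF HY Z, folded c'_def]
  show thesis
  proof
    show "integrable M J"
      unfolding J_def[abs_def] using terms eH_int by auto
    have "(\<integral>\<omega>. J \<omega> \<partial>M) = (\<integral>\<omega>. (\<Sum>k\<in>C. entropy_term (c k \<omega>)) \<partial>M) - (\<integral>\<omega>. (\<Sum>k\<in>C. e k (H \<omega>)) \<partial>M)"
      unfolding J_def using terms eH_int by (intro Bochner_Integration.integral_diff) auto
    also have "(\<integral>\<omega>. (\<Sum>k\<in>C. e k (H \<omega>)) \<partial>M) = (\<integral>\<omega>. (\<Sum>k\<in>C. entropy_term (c' k \<omega>)) \<partial>M)"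
      using terms' eH_int by (simp add: Bochner_Integration.integral_sum c'_int)
    finally show "(\<integral>\<omega>. J \<omega> \<partial>M) = entropy_given M N H C Z - entropy_given M (N \<Otimes>\<^sub>M T) (\<lambda>\<omega>. (H \<omega>, Y \<omega>)) C Z"
      by (simp add: entropy_given_def c_def c'_def)
    have "AE \<omega> in M. \<forall>k\<in>C. c k \<omega> = p k (H \<omega>)"
      using p_eq C by (simp add: AE_ball_countable countable_finite)
    then show "AE \<omega> in M. prob_space.mutual_information (\<kappa> (H \<omega>)) (exp 1) (count_space C) T fst snd = J \<omega> \<and> 0 \<le> J \<omega>"
      using dens AE_space
    proof eventually_elim
      case (elim \<omega>)
      have h: "H \<omega> \<in> space N" using HN elim(3) .
      have fm: "(\<lambda>y. f k (H \<omega>, y)) \<in> borel_measurable T" for k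
        using h by measurable
      have d: "emeasure (\<kappa> (H \<omega>)) ({k} \<times> B) = (\<integral>\<^sup>+y. ennreal (f k (H \<omega>, y)) * indicator B y \<partial>distr (\<kappa> (H \<omega>)) T snd)"
        if "k \<in> C" "B \<in> sets T" for k B
        using elim(2) that by (simp add: v_def \<mu>_def)
      have mi: "prob_space.mutual_information (\<kappa> (H \<omega>)) (exp 1) (count_space C) T fst snd =
          (\<Sum>k\<in>C. entropy_term (p k (H \<omega>))) -
          (\<Sum>k\<in>C. \<integral>y. entropy_term (f k (H \<omega>, y)) \<partial>\<mu> (H \<omega>))"
        unfolding p_def \<mu>_def
        by (rule mutual_information_finite_fst(1)[OF kernel_simps(1,2)[OF \<kappa> h] C fm f_bnd]) (rule d)
      have mi0: "0 \<le> prob_space.mutual_information (\<kappa> (H \<omega>)) (exp 1) (count_space C) T fst snd"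
        by (rule mutual_information_finite_fst(2)[OF kernel_simps(1,2)[OF \<kappa> h] C fm f_bnd]) (rule d)
      have "J \<omega> = (\<Sum>k\<in>C. entropy_term (p k (H \<omega>))) -
          (\<Sum>k\<in>C. \<integral>y. entropy_term (f k (H \<omega>, y)) \<partial>\<mu> (H \<omega>))"
        unfolding J_def using elim(1) by (simp add: e_int[OF h])
      then show ?case
        using mi mi0 by simp
    qed
  qed
qed

end

text \<open>The type is merely a metric space, so countability must come from \<open>S\<close>:
  total boundedness gives, for every radius 1 / (n + 1), a finite cover by balls, and the traces of
  all these balls form a countable base of \<open>S\<close>.\<close>

lemma compact_borel_countably_generated:
  fixes S :: "'a::metric_space set"
  assumes "compact S"
  obtains G where "countable G" "G \<subseteq> Pow S" "sets (restrict_space borel S) = sigma_sets S G"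
proof -
  have "\<exists>k. finite k \<and> k \<subseteq> S \<and> S \<subseteq> (\<Union>x\<in>k. ball x (1 / Suc n))" for n :: nat
    using seq_compact_imp_totally_bounded[OF compact_imp_seq_compact[OF assms]] by simp
  then obtain F where F: "\<And>n. finite (F n)" "\<And>n. S \<subseteq> (\<Union>x\<in>F n. ball x (1 / Suc n))"
    by metis
  define G where "G = (\<Union>n. (\<lambda>x. S \<inter> ball x (1 / Suc n)) ` F n)"
  have "countable (F n)" for n by (rule countable_finite[OF F(1)])
  then have G: "countable G" "G \<subseteq> Pow S"
    unfolding G_def by (blast intro: countable_UN[OF countableI_type] countable_image, blast)
  interpret sigma_algebra S "sigma_sets S G" by (rule sigma_algebra_sigma_sets[OF G(2)])
  have "(\<lambda>x. x) \<in> borel_measurable (sigma S G)"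
  proof (rule borel_measurableI)
    fix U :: "'a set" assume U: "open U"
    have "S \<inter> U = \<Union>{g\<in>G. g \<subseteq> U}"
    proof (intro set_eqI iffI)
      fix x assume x: "x \<in> S \<inter> U"
      then obtain e where e: "0 < e" "ball x e \<subseteq> U" using U openE by auto
      \<comment> \<open>A ball of radius below \<open>e / 2\<close> that contains \<open>x\<close>
        stays inside \<open>ball x e\<close>.\<close>
      obtain n :: nat where n: "1 / Suc n < e / 2"
        using nat_approx_posE[of "e / 2"] e(1) by auto
      obtain y where y: "y \<in> F n" "x \<in> ball y (1 / Suc n)" using F(2)[of n] x by auto
      have "ball y (1 / Suc n) \<subseteq> ball x e"
      proof
        fix z assume "z \<in> ball y (1 / Suc n)"
        then have "dist x z \<le> dist x y + dist y z" "dist y z < e / 2" "dist y x < e / 2"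
          using n y(2) by (auto simp: dist_triangle)
        then show "z \<in> ball x e" by (simp add: dist_commute)
      qed
      then have "S \<inter> ball y (1 / Suc n) \<in> {g\<in>G. g \<subseteq> U}"
        unfolding G_def using e(2) y(1) by blast
      then show "x \<in> \<Union>{g\<in>G. g \<subseteq> U}" using x y(2) by blast
    qed (use G(2) in auto)
    also have "\<dots> \<in> sigma_sets S G"
      by (rule countable_Union) (auto intro!: countable_subset[OF _ G(1)])
    finally show "(\<lambda>x. x) -` U \<inter> space (sigma S G) \<in> sets (sigma S G)"
      using G(2) by (simp add: Int_commute)
  qed
  then have "(\<lambda>x. x) -` B \<inter> space (sigma S G) \<in> sets (sigma S G)" if "B \<in> sets borel" for B
    using that by (rule measurable_sets)
  then have "sets (restrict_space borel S) \<subseteq> sigma_sets S G"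
    using G(2) by (auto simp: sets_restrict_space Int_commute)
  moreover have "sigma_sets S G \<subseteq> sets (restrict_space borel S)"
  proof -
    have "G \<subseteq> sets (restrict_space borel S)"
      unfolding G_def sets_restrict_space by auto
    then show ?thesis
      using sets.sigma_sets_subset[of G "restrict_space borel S"] by (simp add: space_restrict_space)
  qed
  ultimately show thesis using that[OF G] by auto
qed

text \<open>Rectangles of generators recover the cylinder sets once each family covers its space,
  hence the passage to families that contain the whole space.\<close>

lemma pair_countably_generated:
  assumes A: "countable GA" "GA \<subseteq> Pow (space A)" "sets A = sigma_sets (space A) GA"
    and B: "countable GB" "GB \<subseteq> Pow (space B)" "sets B = sigma_sets (space B) GB"
  obtains G where "countable G" "G \<subseteq> Pow (space (A \<Otimes>\<^sub>M B))"
    "sets (A \<Otimes>\<^sub>M B) = sigma_sets (space (A \<Otimes>\<^sub>M B)) G"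
proof -
  obtain GA' where A': "countable GA'" "GA' \<subseteq> Pow (space A)" "space A \<in> GA'"
      "sets A = sigma_sets (space A) GA'"
    using countably_generated_Int_stable[OF A(1,2)] A(3) by metis
  obtain GB' where B': "countable GB'" "GB' \<subseteq> Pow (space B)" "space B \<in> GB'"
      "sets B = sigma_sets (space B) GB'"
    using countably_generated_Int_stable[OF B(1,2)] B(3) by metis
  let ?G = "{a \<times> b |a b. a \<in> GA' \<and> b \<in> GB'}"
  have sub: "?G \<subseteq> Pow (space A \<times> space B)" using A'(2) B'(2) by auto
  have "?G = (\<lambda>(a, b). a \<times> b) ` (GA' \<times> GB')" by auto
  then have "countable ?G" using A'(1) B'(1) by simp
  moreover have "sets (A \<Otimes>\<^sub>M B) = sets (sigma (space A \<times> space B) ?G)"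
    using A' B' by (intro sets_pair_eq[where Ca="{space A}" and Cb="{space B}"]) auto
  ultimately show thesis
    using that[of ?G] sub by (simp add: space_pair_measure)
qed

lemma borel_countably_generated:
  obtains G :: "'a::second_countable_topology set set" where "countable G" "sets borel = sigma_sets UNIV G"
  using ex_countable_basis borel_eq_countable_basis by (metis sets_measure_of subset_UNIV Pow_UNIV)

section \<open>Independent noise, equivalent and trivial conditioning, and the Cauchy--Schwarz
  step\<close>

context prob_space
begin

lemma regular_cond_law_cong:
  assumes rcl: "regular_cond_law M N H S X \<kappa>" and eq: "\<And>\<omega>. \<omega> \<in> space M \<Longrightarrow> X \<omega> = X' \<omega>"
  shows "regular_cond_law M N H S X' \<kappa>"
proof (rule regular_cond_lawI)
  note rcl' = regular_cond_lawD[OF rcl]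
  show "H \<in> M \<rightarrow>\<^sub>M N" "\<kappa> \<in> N \<rightarrow>\<^sub>M prob_algebra S" by (fact rcl')+
  show "X' \<in> M \<rightarrow>\<^sub>M S" using rcl'(2) eq by (simp cong: measurable_cong)
  fix D B assume *: "D \<in> sets N" "B \<in> sets S"
  show "(\<integral>\<^sup>+\<omega>. indicator D (H \<omega>) * indicator B (X' \<omega>) \<partial>M) =
      (\<integral>\<^sup>+\<omega>. indicator D (H \<omega>) * emeasure (\<kappa> (H \<omega>)) B \<partial>M)"
    using regular_cond_law_rectangle[OF rcl *] eq by (simp cong: nn_integral_cong)
qed

text \<open>Independence of \<open>Y\<close> from \<open>H\<close> and \<open>X\<close> jointly
  means that conditioning leaves its law unchanged, hence the constant factor \<open>\<nu>\<close>.
  This is how reward noise is adjoined.\<close>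

lemma regular_cond_law_pair_indep:
  assumes X: "regular_cond_law M N H S X \<kappa>" and Y: "Y \<in> M \<rightarrow>\<^sub>M T" and distr_Y: "distr M T Y = \<nu>"
    and indep: "indep_set (sets (vimage_algebra (space M) (\<lambda>\<omega>. (H \<omega>, X \<omega>)) (N \<Otimes>\<^sub>M S)))
      (sets (vimage_algebra (space M) Y T))"
  shows "regular_cond_law M N H (S \<Otimes>\<^sub>M T) (\<lambda>\<omega>. (X \<omega>, Y \<omega>)) (\<lambda>h. \<kappa> h \<Otimes>\<^sub>M \<nu>)"
proof (rule regular_cond_lawI_generator[OF _ _ _ Int_stable_pair_measure_generator[of S T]])
  note X' = regular_cond_lawD[OF X]
  note [measurable] = X'(1-3) Y
  have sets_\<nu>: "sets \<nu> = sets T" using distr_Y by auto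
  have \<nu>: "prob_space \<nu>" using prob_space_distr[OF Y] distr_Y by simp
  then have "(\<lambda>_. \<nu>) \<in> N \<rightarrow>\<^sub>M prob_algebra T"
    using sets_\<nu> by (simp add: space_prob_algebra)
  then show "H \<in> M \<rightarrow>\<^sub>M N" "(\<lambda>\<omega>. (X \<omega>, Y \<omega>)) \<in> M \<rightarrow>\<^sub>M S \<Otimes>\<^sub>M T"
    "(\<lambda>h. \<kappa> h \<Otimes>\<^sub>M \<nu>) \<in> N \<rightarrow>\<^sub>M prob_algebra (S \<Otimes>\<^sub>M T)"
    by measurable
  show "{a \<times> b |a b. a \<in> sets S \<and> b \<in> sets T} \<subseteq> Pow (space (S \<Otimes>\<^sub>M T))"
    using pair_measure_closed by (simp add: space_pair_measure)
  show "sets (S \<Otimes>\<^sub>M T) = sigma_sets (space (S \<Otimes>\<^sub>M T)) {a \<times> b |a b. a \<in> sets S \<and> b \<in> sets T}"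
    by (simp add: space_pair_measure sets_pair_measure)
  fix D E assume D: "D \<in> sets N" and "E \<in> {a \<times> b |a b. a \<in> sets S \<and> b \<in> sets T}"
  then obtain B C where B: "B \<in> sets S" and C: "C \<in> sets T" and E: "E = B \<times> C" by auto
  note [measurable] = B C D
  let ?P = "(\<lambda>\<omega>. (H \<omega>, X \<omega>)) -` (D \<times> B) \<inter> space M" and ?Q = "Y -` C \<inter> space M"
  have "?P \<in> sets (vimage_algebra (space M) (\<lambda>\<omega>. (H \<omega>, X \<omega>)) (N \<Otimes>\<^sub>M S))"
    "?Q \<in> sets (vimage_algebra (space M) Y T)"
    by (intro in_vimage_algebra; measurable)+
  then have "prob (?P \<inter> ?Q) = prob ?P * prob ?Q"
    by (rule indep_setD[OF indep])
  then have PQ: "emeasure M (?P \<inter> ?Q) = emeasure M ?P * emeasure M ?Q"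
    by (simp add: emeasure_eq_measure ennreal_mult)
  have "?P \<in> sets M" "?Q \<in> sets M" by measurable
  have "(\<integral>\<^sup>+\<omega>. indicator D (H \<omega>) * indicator E (X \<omega>, Y \<omega>) \<partial>M) = (\<integral>\<^sup>+\<omega>. indicator (?P \<inter> ?Q) \<omega> \<partial>M)"
    by (intro nn_integral_cong) (auto simp: E split: split_indicator)
  also have "\<dots> = emeasure M ?P * emeasure M ?Q"
    using \<open>?P \<in> sets M\<close> \<open>?Q \<in> sets M\<close> PQ by simp
  also have "emeasure M ?P = (\<integral>\<^sup>+\<omega>. indicator ?P \<omega> \<partial>M)"
    using \<open>?P \<in> sets M\<close> by simp
  also have "\<dots> = (\<integral>\<^sup>+\<omega>. indicator D (H \<omega>) * indicator B (X \<omega>) \<partial>M)"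
    by (intro nn_integral_cong) (auto split: split_indicator)
  also have "\<dots> = (\<integral>\<^sup>+\<omega>. indicator D (H \<omega>) * emeasure (\<kappa> (H \<omega>)) B \<partial>M)"
    by (rule regular_cond_law_rectangle[OF X D B])
  also have "emeasure M ?Q = emeasure \<nu> C"
    using C by (simp add: distr_Y[symmetric] emeasure_distr)
  also have "(\<integral>\<^sup>+\<omega>. indicator D (H \<omega>) * emeasure (\<kappa> (H \<omega>)) B \<partial>M) * emeasure \<nu> C =
      (\<integral>\<^sup>+\<omega>. indicator D (H \<omega>) * emeasure (\<kappa> (H \<omega>)) B * emeasure \<nu> C \<partial>M)"
    by (rule nn_integral_multc[symmetric]) measurable
  also have "\<dots> = (\<integral>\<^sup>+\<omega>. indicator D (H \<omega>) * emeasure (\<kappa> (H \<omega>) \<Otimes>\<^sub>M \<nu>) E \<partial>M)"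
  proof (rule nn_integral_cong)
    fix \<omega> assume "\<omega> \<in> space M"
    then have h: "H \<omega> \<in> space N" by (rule measurable_space[OF X'(1)])
    interpret L: prob_space \<nu> by fact
    show "indicator D (H \<omega>) * emeasure (\<kappa> (H \<omega>)) B * emeasure \<nu> C =
      indicator D (H \<omega>) * emeasure (\<kappa> (H \<omega>) \<Otimes>\<^sub>M \<nu>) E"
      unfolding E using B C kernel_simps(2)[OF X'(3) h] sets_\<nu>
      by (subst L.emeasure_pair_measure_Times) (auto simp: mult.assoc)
  qed
  finally show "(\<integral>\<^sup>+\<omega>. indicator D (H \<omega>) * indicator E (X \<omega>, Y \<omega>) \<partial>M) =
      (\<integral>\<^sup>+\<omega>. indicator D (H \<omega>) * emeasure (\<kappa> (H \<omega>) \<Otimes>\<^sub>M \<nu>) E \<partial>M)" .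
qed

text \<open>Variables that are measurable functions of each other generate the same algebra. The
  conditional expectations are then equal as functions, not merely almost everywhere.\<close>

lemma cond_exp_given_bimeasurable:
  assumes H: "H \<in> M \<rightarrow>\<^sub>M N" and f: "f \<in> N \<rightarrow>\<^sub>M N'" and g: "g \<in> N' \<rightarrow>\<^sub>M N"
    and H': "\<And>\<omega>. \<omega> \<in> space M \<Longrightarrow> H' \<omega> = f (H \<omega>)" and H_eq: "\<And>\<omega>. \<omega> \<in> space M \<Longrightarrow> H \<omega> = g (H' \<omega>)"
  shows "cond_exp_given M N' H' = cond_exp_given M N H"
proof -
  let ?V = "vimage_algebra (space M) H N" and ?V' = "vimage_algebra (space M) H' N'"
  have HV: "H \<in> ?V \<rightarrow>\<^sub>M N"
    using measurable_space[OF H] by (intro measurable_vimage_algebra1) auto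
  have H'V: "H' \<in> ?V' \<rightarrow>\<^sub>M N'"
    using measurable_space[OF f] measurable_space[OF H] by (intro measurable_vimage_algebra1) (auto simp: H')
  have "H' \<in> ?V \<rightarrow>\<^sub>M N'"
    using measurable_compose[OF HV f] by (subst measurable_cong[where g="\<lambda>\<omega>. f (H \<omega>)"]) (auto simp: H')
  moreover have "H \<in> ?V' \<rightarrow>\<^sub>M N"
    using measurable_compose[OF H'V g] by (subst measurable_cong[where g="\<lambda>\<omega>. g (H' \<omega>)"]) (auto simp: H_eq)
  ultimately have "sets ?V' = sets ?V"
    using sets_image_in_sets[of ?V "space M" H' N'] sets_image_in_sets[of ?V' "space M" H N] by auto
  \<comment> \<open>Both algebras carry the zero measure, so equality of their events is equality of
    measure spaces.\<close>
  then have "?V' = ?V"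
    by (rule measure_eqI) (simp add: vimage_algebra_def emeasure_sigma)
  then show ?thesis
    by (intro ext) (simp add: cond_exp_given_def)
qed

text \<open>A constant generates the trivial algebra, so conditional probabilities are plain
  probabilities. This is the start of the telescoping sum, where the history is still empty.\<close>

lemma entropy_given_const:
  assumes Z: "Z \<in> M \<rightarrow>\<^sub>M count_space C" and C: "finite C"
    and h: "h \<in> space N" "\<And>\<omega>. \<omega> \<in> space M \<Longrightarrow> H \<omega> = h"
  shows "entropy_given M N H C Z = entropy (exp 1) (count_space C) Z"
proof -
  interpret information_space M "exp 1" by unfold_locales simp
  have H: "H \<in> M \<rightarrow>\<^sub>M N" using h by (simp cong: measurable_cong)
  define p where "p k = prob (Z -` {k} \<inter> space M)" for k
  have ind: "integrable M (\<lambda>\<omega>. indicator {k} (Z \<omega>) :: real)" for k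
    by (rule integrable_const_bound[where B=1])
      (use Z in \<open>auto intro!: measurable_compose[OF Z] split: split_indicator\<close>)
  have Zk: "Z -` {k} \<inter> space M \<in> sets M" if "k \<in> C" for k
    using measurable_sets[OF Z, of "{k}"] that by simp
  have p: "(\<integral>\<omega>. indicator {k} (Z \<omega>) \<partial>M) = p k" if "k \<in> C" for k
  proof -
    have "(\<integral>\<omega>. indicator {k} (Z \<omega>) \<partial>M) = (\<integral>\<omega>. indicator (Z -` {k} \<inter> space M) \<omega> \<partial>M :: real)"
      by (rule Bochner_Integration.integral_cong) (auto split: split_indicator)
    then show ?thesis using Zk[OF that] by (simp add: p_def)
  qed
  have "AE \<omega> in M. cond_exp_given M N H (\<lambda>\<omega>. indicator {k} (Z \<omega>)) \<omega> = (\<lambda>_. p k) (H \<omega>)" if "k \<in> C" for k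
  proof (rule cond_exp_given_eqI[OF H ind])
    fix D
    have "(\<integral>\<omega>. indicator D (H \<omega>) * indicator {k} (Z \<omega>) \<partial>M) =
        (\<integral>\<omega>. indicator D h * indicator {k} (Z \<omega>) \<partial>M :: real)"
      by (rule Bochner_Integration.integral_cong) (simp_all only: h(2))
    also have "\<dots> = (\<integral>\<omega>. indicator D h * p k \<partial>M)"
      by (simp add: p[OF that] prob_space)
    also have "\<dots> = (\<integral>\<omega>. indicator D (H \<omega>) * p k \<partial>M)"
      by (rule Bochner_Integration.integral_cong) (simp_all only: h(2))
    finally show "(\<integral>\<omega>. indicator D (H \<omega>) * indicator {k} (Z \<omega>) \<partial>M) =
        (\<integral>\<omega>. indicator D (H \<omega>) * p k \<partial>M)" .
  qed auto
  then have "AE \<omega> in M. \<forall>k\<in>C. cond_exp_given M N H (\<lambda>\<omega>. indicator {k} (Z \<omega>)) \<omega> = p k"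
    using C by (simp add: AE_ball_countable countable_finite)
  then have "entropy_given M N H C Z = (\<integral>\<omega>. (\<Sum>k\<in>C. entropy_term (p k)) \<partial>M)"
    unfolding entropy_given_def by (intro integral_cong_AE) (auto elim!: eventually_mono)
  then have 1: "entropy_given M N H C Z = (\<Sum>k\<in>C. entropy_term (p k))"
    by (simp add: prob_space)
  have "distributed M (count_space C) Z (\<lambda>k. ennreal (p k))"
    unfolding distributed_def
  proof (intro conjI Z)
    show "distr M (count_space C) Z = density (count_space C) (\<lambda>k. ennreal (p k))"
    proof (rule measure_eqI_finite[of _ C])
      fix k assume "k \<in> C"
      then show "emeasure (distr M (count_space C) Z) {k} =
          emeasure (density (count_space C) (\<lambda>k. ennreal (p k))) {k}"
        using C Z by (simp add: emeasure_distr emeasure_density p_def emeasure_eq_measure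
            nn_integral_count_space_finite indicator_def if_distrib cong: if_cong)
    qed (use C in auto)
  qed auto
  then have "entropy (exp 1) (count_space C) Z = - (\<integral>k. p k * log (exp 1) (p k) \<partial>count_space C)"
    by (rule entropy_distr) (simp add: p_def)
  also have "\<dots> = (\<Sum>k\<in>C. entropy_term (p k))"
    using C by (simp add: lebesgue_integral_count_space_finite entropy_term_def log_def sum_negf)
  finally show ?thesis using 1 by simp
qed

text \<open>By AM-GM, \<open>d \<le> (c d\<^sup>2 / i + i / c) / 2\<close> for every \<open>c > 0\<close>; optimising over \<open>c\<close> replaces
  Cauchy--Schwarz.\<close>

lemma sum_integral_le_sqrt_information_ratio:
  assumes S: "finite S" and d: "\<And>t. t \<in> S \<Longrightarrow> integrable M (d t)" and J: "\<And>t. t \<in> S \<Longrightarrow> integrable M (J t)"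
    and J_nn: "\<And>t. t \<in> S \<Longrightarrow> AE \<omega> in M. 0 \<le> J t \<omega>"
    and ratio: "(\<Sum>t\<in>S. \<integral>\<^sup>+\<omega>. information_ratio (d t \<omega>) (J t \<omega>) \<partial>M) \<le> ennreal G" and G: "0 < G"
    and h: "(\<Sum>t\<in>S. \<integral>\<omega>. J t \<omega> \<partial>M) \<le> h"
  shows "(\<Sum>t\<in>S. \<integral>\<omega>. d t \<omega> \<partial>M) \<le> sqrt (G * h)"
proof -
  define g where "g t \<omega> = information_ratio (d t \<omega>) (J t \<omega>)" for t \<omega>
  have g_meas[measurable]: "g t \<in> borel_measurable M" if "t \<in> S" for t
  proof -
    have [measurable]: "d t \<in> borel_measurable M" "J t \<in> borel_measurable M"
      using d[OF that] J[OF that] by auto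
    show ?thesis unfolding g_def information_ratio_def by measurable
  qed
  have g_int: "(\<integral>\<^sup>+\<omega>. g t \<omega> \<partial>M) < \<infinity>" if "t \<in> S" for t
  proof -
    have "(\<integral>\<^sup>+\<omega>. g t \<omega> \<partial>M) \<le> (\<Sum>t\<in>S. \<integral>\<^sup>+\<omega>. g t \<omega> \<partial>M)"
      using S that by (intro member_le_sum) auto
    also have "\<dots> \<le> ennreal G" using ratio by (simp add: g_def)
    finally show ?thesis by (simp add: le_less_trans)
  qed
  have g_fin: "AE \<omega> in M. g t \<omega> \<noteq> \<infinity>" if "t \<in> S" for t
    using g_int[OF that] g_meas[OF that] by (intro nn_integral_noteq_infinite) auto
  have g_real: "integrable M (\<lambda>\<omega>. enn2real (g t \<omega>))"
    "ennreal (\<integral>\<omega>. enn2real (g t \<omega>) \<partial>M) = (\<integral>\<^sup>+\<omega>. g t \<omega> \<partial>M)" if "t \<in> S" for t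
  proof -
    have eq: "(\<integral>\<^sup>+\<omega>. ennreal (enn2real (g t \<omega>)) \<partial>M) = (\<integral>\<^sup>+\<omega>. g t \<omega> \<partial>M)"
      using g_fin[OF that] by (intro nn_integral_cong_AE) (auto elim!: eventually_mono simp: less_top)
    show i: "integrable M (\<lambda>\<omega>. enn2real (g t \<omega>))"
      using g_meas[OF that] g_int[OF that] eq by (intro integrableI_nonneg) auto
    show "ennreal (\<integral>\<omega>. enn2real (g t \<omega>) \<partial>M) = (\<integral>\<^sup>+\<omega>. g t \<omega> \<partial>M)"
      using nn_integral_eq_integral[OF i] eq by simp
  qed
  have sum_g: "(\<Sum>t\<in>S. \<integral>\<omega>. enn2real (g t \<omega>) \<partial>M) \<le> G"
  proof -
    have "ennreal (\<Sum>t\<in>S. \<integral>\<omega>. enn2real (g t \<omega>) \<partial>M) = (\<Sum>t\<in>S. \<integral>\<^sup>+\<omega>. g t \<omega> \<partial>M)"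
      using g_real(2) by (simp add: sum_ennreal[symmetric] integral_nonneg)
    also have "\<dots> \<le> ennreal G" using ratio by (simp add: g_def)
    finally show ?thesis using G by (subst (asm) ennreal_le_iff) auto
  qed
  have sum_J: "0 \<le> (\<Sum>t\<in>S. \<integral>\<omega>. J t \<omega> \<partial>M)"
    using J_nn by (intro sum_nonneg integral_nonneg_AE) auto
  have pt: "AE \<omega> in M. d t \<omega> \<le> (c * enn2real (g t \<omega>) + J t \<omega> / c) / 2" if t: "t \<in> S" and c: "0 < c" for t c
    using g_fin[OF t] J_nn[OF t]
  proof eventually_elim
    case (elim \<omega>)
    show ?case
    proof (cases "J t \<omega> = 0")
      case True
      \<comment> \<open>A zero denominator under a nonzero \<open>d\<close> would make the ratio
        infinite, contrary to \<open>g_fin\<close>.\<close>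
      then have "d t \<omega> = 0"
        using elim(1) by (cases "d t \<omega> = 0") (auto simp: g_def information_ratio_def ennreal_divide_zero)
      then show ?thesis using True c by simp
    next
      case False
      then have i: "0 < J t \<omega>" using elim(2) by simp
      then have g: "enn2real (g t \<omega>) = (d t \<omega>)\<^sup>2 / J t \<omega>"
        by (simp add: g_def information_ratio_def divide_ennreal)
      \<comment> \<open>The AM-GM inequality in completed-square form; expanding leaves exactly the
        required bound on \<open>2 * d\<close>.\<close>
      have "0 \<le> (c * d t \<omega> - J t \<omega>)\<^sup>2 / (c * J t \<omega>)"
        using c i by simp
      also have "\<dots> = c * ((d t \<omega>)\<^sup>2 / J t \<omega>) + J t \<omega> / c - 2 * d t \<omega>"
        using c i by (simp add: field_simps power2_eq_square)
      finally show ?thesis unfolding g by simp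
    qed
  qed
  have bound: "(\<Sum>t\<in>S. \<integral>\<omega>. d t \<omega> \<partial>M) \<le> (c * G + h / c) / 2" if c: "0 < c" for c
  proof -
    have "(\<Sum>t\<in>S. \<integral>\<omega>. d t \<omega> \<partial>M) \<le> (\<Sum>t\<in>S. \<integral>\<omega>. (c * enn2real (g t \<omega>) + J t \<omega> / c) / 2 \<partial>M)"
      using d J g_real(1) pt c by (intro sum_mono integral_mono_AE) auto
    also have "\<dots> = (\<Sum>t\<in>S. (c * (\<integral>\<omega>. enn2real (g t \<omega>) \<partial>M) + (\<integral>\<omega>. J t \<omega> \<partial>M) / c) / 2)"
      using J g_real(1) by (intro sum.cong) auto
    also have "\<dots> = (c * (\<Sum>t\<in>S. \<integral>\<omega>. enn2real (g t \<omega>) \<partial>M) + (\<Sum>t\<in>S. \<integral>\<omega>. J t \<omega> \<partial>M) / c) / 2"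
      by (simp add: sum_divide_distrib[symmetric] sum.distrib sum_distrib_left)
    also have "\<dots> \<le> (c * G + h / c) / 2"
      using sum_g h c by (intro divide_right_mono add_mono mult_left_mono) auto
    finally show ?thesis .
  qed
  have "0 \<le> h" using sum_J h by simp
  show ?thesis
  proof (cases "h = 0")
    case True
    \<comment> \<open>For \<open>h = 0\<close> the optimal \<open>c\<close> degenerates to 0, so
      \<open>c\<close> is sent there: \<open>c = 2 * e / G\<close> turns the bound into
      \<open>e\<close>.\<close>
    have "(\<Sum>t\<in>S. \<integral>\<omega>. d t \<omega> \<partial>M) \<le> 0 + e" if "0 < e" for e
      using bound[of "2 * e / G"] that G True by simp
    then have "(\<Sum>t\<in>S. \<integral>\<omega>. d t \<omega> \<partial>M) \<le> 0"
      by (rule field_le_epsilon)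
    then show ?thesis using True by simp
  next
    case False
    then have h0: "0 < h" using \<open>0 \<le> h\<close> by simp
    \<comment> \<open>The minimiser of \<open>c * G + h / c\<close> is the root of
      \<open>h / G\<close>, that is \<open>s / r\<close>.\<close>
    define s where "s = sqrt h" define r where "r = sqrt G"
    have sr: "0 < s" "0 < r" "h = s * s" "G = r * r" using h0 G by (auto simp: s_def r_def)
    have "(s / r * G + h / (s / r)) / 2 = r * s"
      using sr(1,2) by (simp add: sr(3,4))
    also have "r * s = sqrt (G * h)" by (simp add: s_def r_def real_sqrt_mult)
    finally show ?thesis using bound[of "s / r"] sr(1,2) by simp
  qed
qed

end


section \<open>Thompson sampling\<close>

lemma cell_index_eq:
  assumes "disjoint_family_on cell {1..K}" "k \<in> {1..K}" "a \<in> cell k"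
  shows "cell_index K cell a = k"
  unfolding cell_index_def
proof (rule the_equality)
  fix j assume "j \<in> {1..K} \<and> a \<in> cell j"
  then show "j = k"
    using assms unfolding disjoint_family_on_def by blast
qed (use assms in simp)

lemma measurable_cell_index:
  assumes sets: "\<And>k. k \<in> {1..K} \<Longrightarrow> cell k \<in> sets (restrict_space borel S)"
    and disj: "disjoint_family_on cell {1..K}" and cover: "(\<Union>k\<in>{1..K}. cell k) = S"
  shows "cell_index K cell \<in> restrict_space borel S \<rightarrow>\<^sub>M count_space {1..K}"
proof -
  have "cell_index K cell a \<in> {1..K}" if "a \<in> S" for a
    using that cover cell_index_eq[OF disj] by blast
  moreover have "cell_index K cell -` {k} \<inter> S = cell k" if "k \<in> {1..K}" for k
    using that cover cell_index_eq[OF disj] by blast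
  ultimately show ?thesis
    using sets by (subst measurable_count_space_eq2) (auto simp: space_restrict_space)
qed

text \<open>No sign is assumed on \<open>i\<close>: a nonpositive \<open>i\<close> becomes 0 in
  \<open>ennreal\<close>, where the ratio is infinite unless \<open>d = 0\<close>, and then both
  ratios vanish. Hence it applies to a compressed information of unknown sign.\<close>

lemma information_ratio_antimono:
  assumes "i \<le> j"
  shows "information_ratio d j \<le> information_ratio d i"
proof (cases "0 < i")
  case True
  then show ?thesis
    using assms by (simp add: information_ratio_def divide_ennreal divide_left_mono)
next
  case False
  then show ?thesis
    by (cases "d = 0") (simp_all add: information_ratio_def ennreal_neg ennreal_divide_zero)
qed

section \<open>Measurability and growth of the history\<close>

context bayesian_bandit
begin

lemma measurable_hist [measurable]:
  assumes "t \<in> {1..T}"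
  shows "hist R \<Theta> \<xi> A t \<in> M \<rightarrow>\<^sub>M hist_space acts t"
  using action_cond_indep[OF assms] by (simp add: cond_indep_def)

lemma measurable_action [measurable]:
  assumes "t \<in> {1..T}"
  shows "A t \<in> M \<rightarrow>\<^sub>M restrict_space borel acts"
  using action_cond_indep[OF assms] by (simp add: cond_indep_def)

lemma measurable_reward [measurable (raw)]:
  assumes B: "B \<in> L \<rightarrow>\<^sub>M restrict_space borel acts" and X: "X \<in> L \<rightarrow>\<^sub>M prior" and Y: "Y \<in> L \<rightarrow>\<^sub>M noise"
  shows "(\<lambda>\<omega>. R (B \<omega>) (X \<omega>) (Y \<omega>)) \<in> borel_measurable L"
  using measurable_compose[OF measurable_Pair[OF B measurable_Pair[OF X Y]] measurable_R] by simp

text \<open>Restricting to the old indices together with reading off coordinate \<open>t\<close> is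
  inverse to the update at \<open>t\<close>, and both maps are measurable. This matches the last
  entropy of one chain rule with the first entropy of the next.\<close>

lemma cond_exp_given_hist_Suc:
  assumes t: "t \<in> {1..T}"
  shows "cond_exp_given M (hist_space acts (Suc t)) (hist R \<Theta> \<xi> A (Suc t)) =
    cond_exp_given M (hist_space acts t \<Otimes>\<^sub>M (restrict_space borel acts \<Otimes>\<^sub>M borel))
      (\<lambda>\<omega>. (hist R \<Theta> \<xi> A t \<omega>, (A t \<omega>, R (A t \<omega>) (\<Theta> \<omega>) (\<xi> t \<omega>))))"
proof (rule cond_exp_given_bimeasurable)
  let ?L = "restrict_space borel acts \<Otimes>\<^sub>M (borel :: real measure)"
  \<comment> \<open>This needs \<open>1 \<le> t\<close>: for \<open>t = 0\<close> both intervals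
    would be empty.\<close>
  have ins: "{1..<Suc t} = insert t {1..<t}" using t by auto
  note [measurable] = measurable_\<Theta> measurable_noise[OF t] measurable_hist[OF t] measurable_action[OF t]
  show "(\<lambda>\<omega>. (hist R \<Theta> \<xi> A t \<omega>, (A t \<omega>, R (A t \<omega>) (\<Theta> \<omega>) (\<xi> t \<omega>)))) \<in>
      M \<rightarrow>\<^sub>M hist_space acts t \<Otimes>\<^sub>M ?L"
    by measurable
  show "(\<lambda>(f, y). f(t := y)) \<in> hist_space acts t \<Otimes>\<^sub>M ?L \<rightarrow>\<^sub>M hist_space acts (Suc t)"
    unfolding hist_space_def ins by (rule measurable_add_dim)
  show "(\<lambda>h. (restrict h {1..<t}, h t)) \<in> hist_space acts (Suc t) \<rightarrow>\<^sub>M hist_space acts t \<Otimes>\<^sub>M ?L"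
    unfolding hist_space_def using t
    by (intro measurable_Pair measurable_restrict_subset measurable_component_singleton) auto
  fix \<omega> assume "\<omega> \<in> space M"
  show "hist R \<Theta> \<xi> A (Suc t) \<omega> =
      (\<lambda>(f, y). f(t := y)) (hist R \<Theta> \<xi> A t \<omega>, (A t \<omega>, R (A t \<omega>) (\<Theta> \<omega>) (\<xi> t \<omega>)))"
    unfolding hist_def ins by (auto simp: restrict_def fun_eq_iff)
  show "(hist R \<Theta> \<xi> A t \<omega>, (A t \<omega>, R (A t \<omega>) (\<Theta> \<omega>) (\<xi> t \<omega>))) =
      (restrict (hist R \<Theta> \<xi> A (Suc t) \<omega>) {1..<t}, hist R \<Theta> \<xi> A (Suc t) \<omega> t)"
    unfolding hist_def using t by (auto simp: restrict_def fun_eq_iff)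
qed

lemma actions_rewards_countably_generated:
  obtains G where "countable G" "G \<subseteq> Pow (space (restrict_space borel acts \<Otimes>\<^sub>M (borel :: real measure)))"
    "sets (restrict_space borel acts \<Otimes>\<^sub>M (borel :: real measure)) =
      sigma_sets (space (restrict_space borel acts \<Otimes>\<^sub>M (borel :: real measure))) G"
proof -
  obtain G1 where G1: "countable G1" "G1 \<subseteq> Pow acts" "sets (restrict_space borel acts) = sigma_sets acts G1"
    using compact_borel_countably_generated[OF compact_acts] .
  obtain G2 :: "real set set" where G2: "countable G2" "sets borel = sigma_sets UNIV G2"
    by (rule borel_countably_generated)
  show thesis
    by (rule pair_countably_generated[where A="restrict_space borel acts" and B="borel :: real measure"
          and GA=G1 and GB=G2]) (use G1 G2 that in \<open>auto simp: space_restrict_space\<close>)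
qed

end

section \<open>Total information gained by Thompson sampling\<close>

context thompson_sampling
begin

text \<open>The conditional law is the image of posterior \<open>\<otimes>\<close> (image of the posterior under \<open>opt\<close>) \<open>\<otimes>\<close>
  noise, so its existence needs no disintegration theorem.\<close>

lemma regular_cond_law_action_reward:
  assumes t: "t \<in> {1..T}" and f: "f \<in> restrict_space borel acts \<rightarrow>\<^sub>M S"
  shows "\<exists>\<kappa>. regular_cond_law M (hist_space acts t) (hist R \<Theta> \<xi> A t)
    (S \<Otimes>\<^sub>M (restrict_space borel acts \<Otimes>\<^sub>M borel))
    (\<lambda>\<omega>. (f (opt (\<Theta> \<omega>)), (A t \<omega>, R (A t \<omega>) (\<Theta> \<omega>) (\<xi> t \<omega>)))) \<kappa>"
proof -
  note [measurable] = f measurable_opt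
  \<comment> \<open>The sample \<open>\<Theta>s t\<close> has the posterior as its conditional law,
    and the action is its image under \<open>opt\<close>.\<close>
  have A: "regular_cond_law M (hist_space acts t) (hist R \<Theta> \<xi> A t) (restrict_space borel acts) (A t)
      (\<lambda>h. distr (posterior t h) (restrict_space borel acts) opt)"
    using regular_cond_law_cong[OF regular_cond_law_compose[OF sample_law[OF t] measurable_opt]]
    by (simp add: action_eq[OF t])
  note pair = regular_cond_law_pair[OF posterior[OF t] A action_cond_indep[OF t]]
  have g: "(\<lambda>z. (f (opt (fst (fst z))), (snd (fst z), R (snd (fst z)) (fst (fst z)) (snd z)))) \<in>
      (prior \<Otimes>\<^sub>M restrict_space borel acts) \<Otimes>\<^sub>M noise \<rightarrow>\<^sub>M S \<Otimes>\<^sub>M (restrict_space borel acts \<Otimes>\<^sub>M borel)"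
    by measurable
  \<comment> \<open>The noise is independent of history, parameter and action jointly, so it is
    adjoined last, as a constant factor; \<open>g\<close> then reads off the statistic of the
    optimum, the action and the reward.\<close>
  show ?thesis
    using regular_cond_law_compose[OF regular_cond_law_pair_indep[OF pair measurable_noise[OF t]
      distr_noise[OF t] indep_noise[OF t]] g] by auto
qed

text \<open>By the chain rule round \<open>t\<close> costs \<open>e t - e (Suc t)\<close> of the
  entropy still left in the statistic, and no more than the initial entropy can be spent. The
  functions \<open>J t\<close> are integrable stand-ins for the mutual informations.\<close>

lemma sum_mutual_information_le_entropy:
  assumes f: "f \<in> restrict_space borel acts \<rightarrow>\<^sub>M count_space C" and C: "finite C"
  obtains J where "\<And>t. t \<in> {1..T} \<Longrightarrow> integrable M (J t)"
    "\<And>t. t \<in> {1..T} \<Longrightarrow> AE \<omega> in M.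
      mutual_information_given M (hist_space acts t) (hist R \<Theta> \<xi> A t) (count_space C)
        (restrict_space borel acts \<Otimes>\<^sub>M borel) (\<lambda>\<omega>. f (opt (\<Theta> \<omega>)))
        (\<lambda>\<omega>. (A t \<omega>, R (A t \<omega>) (\<Theta> \<omega>) (\<xi> t \<omega>))) \<omega> = J t \<omega> \<and> 0 \<le> J t \<omega>"
    "(\<Sum>t=1..T. \<integral>\<omega>. J t \<omega> \<partial>M) \<le> entropy (exp 1) (count_space C) (\<lambda>\<omega>. f (opt (\<Theta> \<omega>)))"
proof -
  define Z where "Z \<omega> = f (opt (\<Theta> \<omega>))" for \<omega>
  note [measurable] = f measurable_opt measurable_\<Theta>
  have Z[measurable]: "Z \<in> M \<rightarrow>\<^sub>M count_space C" unfolding Z_def[abs_def] by measurable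
  define e where "e t = entropy_given M (hist_space acts t) (hist R \<Theta> \<xi> A t) C Z" for t
  obtain G where G: "countable G" "G \<subseteq> Pow (space (restrict_space borel acts \<Otimes>\<^sub>M (borel :: real measure)))"
    "sets (restrict_space borel acts \<Otimes>\<^sub>M (borel :: real measure)) =
      sigma_sets (space (restrict_space borel acts \<Otimes>\<^sub>M (borel :: real measure))) G"
    by (rule actions_rewards_countably_generated)
  have *: "\<forall>t\<in>{1..T}. \<exists>J. integrable M J \<and> (AE \<omega> in M.
      mutual_information_given M (hist_space acts t) (hist R \<Theta> \<xi> A t) (count_space C)
        (restrict_space borel acts \<Otimes>\<^sub>M borel) Z
        (\<lambda>\<omega>. (A t \<omega>, R (A t \<omega>) (\<Theta> \<omega>) (\<xi> t \<omega>))) \<omega> = J \<omega> \<and> 0 \<le> J \<omega>) \<and>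
      (\<integral>\<omega>. J \<omega> \<partial>M) = e t - e (Suc t)"
  proof
    fix t assume t: "t \<in> {1..T}"
    let ?\<kappa> = "cond_law M (hist_space acts t) (hist R \<Theta> \<xi> A t)
      (count_space C \<Otimes>\<^sub>M (restrict_space borel acts \<Otimes>\<^sub>M borel))
      (\<lambda>\<omega>. (Z \<omega>, (A t \<omega>, R (A t \<omega>) (\<Theta> \<omega>) (\<xi> t \<omega>))))"
    have rcl: "regular_cond_law M (hist_space acts t) (hist R \<Theta> \<xi> A t)
      (count_space C \<Otimes>\<^sub>M (restrict_space borel acts \<Otimes>\<^sub>M borel))
      (\<lambda>\<omega>. (Z \<omega>, (A t \<omega>, R (A t \<omega>) (\<Theta> \<omega>) (\<xi> t \<omega>)))) ?\<kappa>"
      \<comment> \<open>Only the existence of a version gives meaning to the choice in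
        \<open>cond_law\<close>.\<close>
      unfolding cond_law_def Z_def using regular_cond_law_action_reward[OF t f] by (rule someI_ex)
    obtain J where J: "integrable M J"
      "AE \<omega> in M. prob_space.mutual_information (?\<kappa> (hist R \<Theta> \<xi> A t \<omega>)) (exp 1) (count_space C)
        (restrict_space borel acts \<Otimes>\<^sub>M borel) fst snd = J \<omega> \<and> 0 \<le> J \<omega>"
      "(\<integral>\<omega>. J \<omega> \<partial>M) = entropy_given M (hist_space acts t) (hist R \<Theta> \<xi> A t) C Z -
        entropy_given M (hist_space acts t \<Otimes>\<^sub>M (restrict_space borel acts \<Otimes>\<^sub>M borel))
          (\<lambda>\<omega>. (hist R \<Theta> \<xi> A t \<omega>, (A t \<omega>, R (A t \<omega>) (\<Theta> \<omega>) (\<xi> t \<omega>)))) C Z"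
      by (rule mutual_information_chain_rule[OF rcl C G])
    have "(\<integral>\<omega>. J \<omega> \<partial>M) = e t - e (Suc t)"
      unfolding J(3) e_def entropy_given_def cond_exp_given_hist_Suc[OF t] ..
    with J(1,2) show "\<exists>J. integrable M J \<and> (AE \<omega> in M.
      mutual_information_given M (hist_space acts t) (hist R \<Theta> \<xi> A t) (count_space C)
        (restrict_space borel acts \<Otimes>\<^sub>M borel) Z
        (\<lambda>\<omega>. (A t \<omega>, R (A t \<omega>) (\<Theta> \<omega>) (\<xi> t \<omega>))) \<omega> = J \<omega> \<and> 0 \<le> J \<omega>) \<and>
      (\<integral>\<omega>. J \<omega> \<partial>M) = e t - e (Suc t)"
      unfolding mutual_information_given_def by (intro exI[of _ J] conjI)
  qed
  from bchoice[OF *] obtain J where J: "\<forall>t\<in>{1..T}. integrable M (J t) \<and> (AE \<omega> in M.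
      mutual_information_given M (hist_space acts t) (hist R \<Theta> \<xi> A t) (count_space C)
        (restrict_space borel acts \<Otimes>\<^sub>M borel) Z
        (\<lambda>\<omega>. (A t \<omega>, R (A t \<omega>) (\<Theta> \<omega>) (\<xi> t \<omega>))) \<omega> = J t \<omega> \<and> 0 \<le> J t \<omega>) \<and>
      (\<integral>\<omega>. J t \<omega> \<partial>M) = e t - e (Suc t)" ..
  have "(\<Sum>t=1..T. \<integral>\<omega>. J t \<omega> \<partial>M) = (\<Sum>t=1..T. e t - e (Suc t))"
    by (rule sum.cong) (use J in auto)
  also have "\<dots> = e 1 - e (Suc T)"
    using sum_Suc_diff[of 1 T "\<lambda>t. - e t"] horizon by simp
  also have "\<dots> \<le> e 1"
  proof -
    \<comment> \<open>\<open>measurable_hist\<close> stops at round \<open>T\<close>, so the entropy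
      after the last round is handled through the history before round \<open>T\<close> paired with
      the last action and reward.\<close>
    have T: "T \<in> {1..T}" using horizon by simp
    note [measurable] = measurable_noise[OF T] measurable_hist[OF T] measurable_action[OF T]
    have "0 \<le> entropy_given M (hist_space acts T \<Otimes>\<^sub>M (restrict_space borel acts \<Otimes>\<^sub>M borel))
          (\<lambda>\<omega>. (hist R \<Theta> \<xi> A T \<omega>, (A T \<omega>, R (A T \<omega>) (\<Theta> \<omega>) (\<xi> T \<omega>)))) C Z"
      by (rule entropy_given_nonneg) measurable
    then show ?thesis
      unfolding e_def entropy_given_def cond_exp_given_hist_Suc[OF T] by simp
  qed
  also have "e 1 = entropy (exp 1) (count_space C) Z"
    unfolding e_def
    \<comment> \<open>Before round 1 the index set is empty, and the history space has the single
      point \<open>\<lambda>_. undefined\<close>.\<close>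
    by (rule entropy_given_const[OF Z C, where h="\<lambda>_. undefined"])
      (auto simp: hist_space_def hist_def space_PiM restrict_def)
  finally show thesis
    using J unfolding Z_def by (intro that[of J]) blast+
qed

end

theorem theorem1:
  fixes M :: "'w measure"
    and acts :: "'a::metric_space set"
    and prior :: "'o measure"
    and noise :: "'n measure"
    and R :: "'a \<Rightarrow> 'o \<Rightarrow> 'n \<Rightarrow> real"
    and opt :: "'o \<Rightarrow> 'a"
    and \<Theta> :: "'w \<Rightarrow> 'o"
    and \<xi> :: "nat \<Rightarrow> 'w \<Rightarrow> 'n"
    and A :: "nat \<Rightarrow> 'w \<Rightarrow> 'a"
    and T :: nat
    and posterior :: "nat \<Rightarrow> (nat \<Rightarrow> 'a \<times> real) \<Rightarrow> 'o measure"
    and \<Theta>s :: "nat \<Rightarrow> 'w \<Rightarrow> 'o"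
    and \<epsilon> \<Gamma> :: real
    and K :: nat
    and cell :: "nat \<Rightarrow> 'a set"
    and \<phi> :: "nat \<Rightarrow> 'w \<Rightarrow> nat \<Rightarrow> 'a"
    and E :: "nat \<Rightarrow> ('w \<Rightarrow> real) \<Rightarrow> 'w \<Rightarrow> real"
    and I :: "nat \<Rightarrow> ('w \<Rightarrow> nat) \<Rightarrow> ('w \<Rightarrow> 'a \<times> real) \<Rightarrow> 'w \<Rightarrow> real"
    and rew :: "nat \<Rightarrow> ('w \<Rightarrow> 'a) \<Rightarrow> 'w \<Rightarrow> real"
    and Astar :: "'w \<Rightarrow> 'a"
    and Astar\<epsilon> :: "'w \<Rightarrow> nat"
    and Ahat\<epsilon> :: "nat \<Rightarrow> 'w \<Rightarrow> nat"
    and Atilde_star Atilde :: "nat \<Rightarrow> 'w \<Rightarrow> 'a"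
  defines "E \<equiv> \<lambda>t. cond_exp_given M (hist_space acts t) (hist R \<Theta> \<xi> A t)"
    and "I \<equiv> \<lambda>t. mutual_information_given M (hist_space acts t) (hist R \<Theta> \<xi> A t)
                   (count_space {1..K}) (restrict_space borel acts \<Otimes>\<^sub>M borel)"
    and "rew \<equiv> \<lambda>t B \<omega>. R (B \<omega>) (\<Theta> \<omega>) (\<xi> t \<omega>)"
    and "Astar \<equiv> \<lambda>\<omega>. opt (\<Theta> \<omega>)"
    and "Astar\<epsilon> \<equiv> \<lambda>\<omega>. cell_index K cell (Astar \<omega>)"
    and "Ahat\<epsilon> \<equiv> \<lambda>t \<omega>. cell_index K cell (A t \<omega>)"
    and "Atilde_star \<equiv> \<lambda>t \<omega>. \<phi> t \<omega> (Astar\<epsilon> \<omega>)"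
    and "Atilde \<equiv> \<lambda>t \<omega>. \<phi> t \<omega> (Ahat\<epsilon> t \<omega>)"
  assumes TS: "thompson_sampling M acts prior noise R opt \<Theta> \<xi> A T posterior \<Theta>s"
    and eps_nonneg: "0 \<le> \<epsilon>"
    and cell_sets: "\<And>k. k \<in> {1..K} \<Longrightarrow> cell k \<in> sets (restrict_space borel acts)"
    and cell_disjoint: "disjoint_family_on cell {1..K}"
    and cell_cover: "(\<Union>k\<in>{1..K}. cell k) = acts"
    and cell_eps: "\<And>k a a'. k \<in> {1..K} \<Longrightarrow> a \<in> cell k \<Longrightarrow> a' \<in> cell k \<Longrightarrow>
      (\<integral>x. R a (inv_into (space prior) opt a) x - R a' (inv_into (space prior) opt a) x \<partial>noise) \<le> \<epsilon>"
    and integrable_rew: "\<And>t. t \<in> {1..T} \<Longrightarrow>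
      integrable M (rew t Astar) \<and> integrable M (rew t (A t)) \<and>
      integrable M (rew t (Atilde_star t)) \<and> integrable M (rew t (Atilde t))"
    and phi: "\<And>t. t \<in> {1..T} \<Longrightarrow>
      cond_indep M (hist_space acts t) (hist R \<Theta> \<xi> A t)
        (\<Pi>\<^sub>M k\<in>{1..K}. restrict_space borel acts) (\<phi> t)
        (prior \<Otimes>\<^sub>M prior \<Otimes>\<^sub>M noise) (\<lambda>\<omega>. (\<Theta> \<omega>, \<Theta>s t \<omega>, \<xi> t \<omega>))"
    and cond1: "\<And>t. t \<in> {1..T} \<Longrightarrow> AE \<omega> in M.
      E t (\<lambda>\<omega>. rew t Astar \<omega> - rew t (A t) \<omega>) \<omega>
        \<le> \<epsilon> + E t (\<lambda>\<omega>. rew t (Atilde_star t) \<omega> - rew t (Atilde t) \<omega>) \<omega>"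
    and cond2: "\<And>t. t \<in> {1..T} \<Longrightarrow> AE \<omega> in M.
      I t Astar\<epsilon> (\<lambda>\<omega>. (Atilde t \<omega>, rew t (Atilde t) \<omega>)) \<omega>
        \<le> I t Astar\<epsilon> (\<lambda>\<omega>. (A t \<omega>, rew t (A t) \<omega>)) \<omega>"
    and Gamma_pos: "0 < \<Gamma>"
    and avg_ratio: "(\<Sum>t=1..T. \<integral>\<^sup>+\<omega>. information_ratio
        (E t (\<lambda>\<omega>. rew t (Atilde_star t) \<omega> - rew t (Atilde t) \<omega>) \<omega>)
        (I t Astar\<epsilon> (\<lambda>\<omega>. (Atilde t \<omega>, rew t (Atilde t) \<omega>)) \<omega>) \<partial>M) / of_nat T \<le> ennreal \<Gamma>"
  shows "(\<integral>\<omega>. (\<Sum>t=1..T. rew t Astar \<omega> - rew t (A t) \<omega>) \<partial>M)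
    \<le> sqrt (\<Gamma> * real T * prob_space.entropy M (exp 1) (count_space {1..K}) Astar\<epsilon>) + \<epsilon> * real T"
proof -
  interpret thompson_sampling M acts prior noise R opt \<Theta> \<xi> A T posterior \<Theta>s by (rule TS)
  define H where "H = entropy (exp 1) (count_space {1..K}) Astar\<epsilon>"
  define d where "d t = E t (\<lambda>\<omega>. rew t (Atilde_star t) \<omega> - rew t (Atilde t) \<omega>)" for t
  obtain J where J: "\<And>t. t \<in> {1..T} \<Longrightarrow> integrable M (J t)"
    "\<And>t. t \<in> {1..T} \<Longrightarrow> AE \<omega> in M. I t Astar\<epsilon> (\<lambda>\<omega>. (A t \<omega>, rew t (A t) \<omega>)) \<omega> = J t \<omega> \<and> 0 \<le> J t \<omega>"
    "(\<Sum>t=1..T. \<integral>\<omega>. J t \<omega> \<partial>M) \<le> H"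
    using sum_mutual_information_le_entropy[OF measurable_cell_index[OF cell_sets cell_disjoint cell_cover] finite_atLeastAtMost]
    unfolding H_def I_def Astar\<epsilon>_def Astar_def rew_def by blast
  have d_int: "integrable M (d t)" if t: "t \<in> {1..T}" for t
    unfolding d_def E_def using integrable_rew[OF t] measurable_hist[OF t]
    by (intro integral_cond_exp_given) auto
  have ratio: "(\<Sum>t=1..T. \<integral>\<^sup>+\<omega>. information_ratio (d t \<omega>) (J t \<omega>) \<partial>M) \<le> ennreal (\<Gamma> * real T)"
  proof -
    define r where "r = (\<Sum>t=1..T. \<integral>\<^sup>+\<omega>. information_ratio (d t \<omega>)
        (I t Astar\<epsilon> (\<lambda>\<omega>. (Atilde t \<omega>, rew t (Atilde t) \<omega>)) \<omega>) \<partial>M)"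
    \<comment> \<open>By condition 2, \<open>J\<close> is the larger denominator. Monotonicity of
      the nonnegative integral holds without measurability of the compressed information.\<close>
    have "(\<integral>\<^sup>+\<omega>. information_ratio (d t \<omega>) (J t \<omega>) \<partial>M) \<le> (\<integral>\<^sup>+\<omega>. information_ratio (d t \<omega>)
        (I t Astar\<epsilon> (\<lambda>\<omega>. (Atilde t \<omega>, rew t (Atilde t) \<omega>)) \<omega>) \<partial>M)" if t: "t \<in> {1..T}" for t
      by (rule nn_integral_mono_AE)
        (use cond2[OF t] J(2)[OF t] in \<open>eventually_elim, simp add: information_ratio_antimono\<close>)
    then have "(\<Sum>t=1..T. \<integral>\<^sup>+\<omega>. information_ratio (d t \<omega>) (J t \<omega>) \<partial>M) \<le> r"
      unfolding r_def by (rule sum_mono)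
    \<comment> \<open>Valid even for infinite \<open>r\<close>, because \<open>T\<close> is nonzero
      and finite.\<close>
    also have "r = r / of_nat T * of_nat T"
      using horizon mult_divide_eq_ennreal[of "of_nat T" r]
      by (simp add: ennreal_divide_times ennreal_times_divide)
    also have "\<dots> \<le> ennreal \<Gamma> * of_nat T"
      using avg_ratio unfolding r_def d_def by (intro mult_right_mono) auto
    also have "\<dots> = ennreal (\<Gamma> * real T)"
      using Gamma_pos by (simp add: ennreal_mult ennreal_of_nat_eq_real_of_nat)
    finally show ?thesis .
  qed
  have T_pos: "0 < real T" using horizon by simp
  have "(\<integral>\<omega>. (\<Sum>t=1..T. rew t Astar \<omega> - rew t (A t) \<omega>) \<partial>M) =
      (\<Sum>t=1..T. \<integral>\<omega>. rew t Astar \<omega> - rew t (A t) \<omega> \<partial>M)"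
    using integrable_rew by (intro Bochner_Integration.integral_sum) auto
  also have "\<dots> \<le> (\<Sum>t=1..T. \<epsilon> + (\<integral>\<omega>. d t \<omega> \<partial>M))"
  proof (rule sum_mono)
    fix t assume t: "t \<in> {1..T}"
    have i: "integrable M (\<lambda>\<omega>. rew t Astar \<omega> - rew t (A t) \<omega>)"
      using integrable_rew[OF t] by auto
    note ce = integral_cond_exp_given[OF measurable_hist[OF t] i]
    have "(\<integral>\<omega>. rew t Astar \<omega> - rew t (A t) \<omega> \<partial>M) = (\<integral>\<omega>. E t (\<lambda>\<omega>. rew t Astar \<omega> - rew t (A t) \<omega>) \<omega> \<partial>M)"
      unfolding E_def by (rule ce(2)[symmetric])
    also have "\<dots> \<le> (\<integral>\<omega>. \<epsilon> + d t \<omega> \<partial>M)"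
      using cond1[OF t] d_int[OF t] ce(1) by (intro integral_mono_AE) (auto simp: d_def E_def)
    also have "\<dots> = \<epsilon> + (\<integral>\<omega>. d t \<omega> \<partial>M)"
      using d_int[OF t] by (simp add: prob_space)
    finally show "(\<integral>\<omega>. rew t Astar \<omega> - rew t (A t) \<omega> \<partial>M) \<le> \<epsilon> + (\<integral>\<omega>. d t \<omega> \<partial>M)" .
  qed
  also have "\<dots> = (\<Sum>t=1..T. \<integral>\<omega>. d t \<omega> \<partial>M) + \<epsilon> * real T"
    by (simp add: sum.distrib mult.commute)
  also have "(\<Sum>t=1..T. \<integral>\<omega>. d t \<omega> \<partial>M) \<le> sqrt (\<Gamma> * real T * H)"
  \<comment> \<open>The two factors under the root are the totals over all rounds:
    \<open>\<Gamma> * real T\<close> for the ratios, \<open>H\<close> for the information.\<close>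
  proof (rule sum_integral_le_sqrt_information_ratio[OF _ d_int J(1) _ ratio _ J(3)])
    show "AE \<omega> in M. 0 \<le> J t \<omega>" if "t \<in> {1..T}" for t
      using J(2)[OF that] by (auto elim: eventually_mono)
    show "0 < \<Gamma> * real T" using Gamma_pos T_pos by simp
  qed auto
  finally show ?thesis
    unfolding H_def by simp
qed

end
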